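(* Let $\nu>1$ and let $J_\nu$ be the Bessel function of the first kind of order $\nu$. The function $$z\mapsto 2^{\nu}\Gamma(\nu-1)z^{2-\frac{\nu}{2}}J_{\nu}''(\sqrt{z})$$ is starlike in $\mathbb{D}$ and all of its derivatives are close-to-convex (and hence univalent) in $\mathbb{D}$ if and only if $\nu\geq\nu^{\ast}$, where $\nu^{\ast}\simeq1.9052\dots$ is the unique root on $(1,\infty)$ of the equation (in the unknown $\nu$) $$(2\nu^2-2\nu-3)J_{\nu}(1)=(\nu^2+\nu-3)J_{\nu+1}(1).$$
   Context: $\mathbb{D}=\{z\in\mathbb{C}:|z|<1\}$ is the open unit disk. The Bessel function of the first kind is $J_\nu(z)=\sum_{n\ge0}\frac{(-1)^n}{n!\,\Gamma(n+\nu+1)}\left(\frac z2\right)^{2n+\nu}$, and $J_\nu''$ is its second derivative with respect to $z$; $J_\nu''(\sqrt z)$ means $J_\nu''$ evaluated at $\sqrt z$. The displayed function is understood as the entire function of $z$ given by its power series (the fractional powers cancel), which has the form $z+O(z^2)$ at $0$. An analytic function $f$ on $\mathbb{D}$ with $f(0)=0$ is starlike in $\mathbb{D}$ if it is univalent there and $f(\mathbb{D})$ is starlike with respect to the origin. An analytic function $h$ on $\mathbb{D}$ (not necessarily normalized) is close-to-convex in $\mathbb{D}$ if there is a univalent function $\varphi$ on $\mathbb{D}$ with convex image such that $\operatorname{Re}(h'(z)/\varphi'(z))>0$ for all $z\in\mathbb{D}$.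
   Formalization: The printed value ν* ≃ 1.9052… is inaccurate: the unique root of the stated equation is about 1.9046, so the formal statement asserts only |ν* − 1.9052| < 1/1000. *)

theory Defs
  imports "HOL-Complex_Analysis.Complex_Analysis"
begin

definition bessel_J :: "real \<Rightarrow> complex \<Rightarrow> complex" where
  "bessel_J \<nu> z =
     (\<Sum>n. (-1) ^ n / of_real (fact n * Gamma (real n + \<nu> + 1))
            * (z / 2) powr of_real (2 * real n + \<nu>))"

text \<open>
  All fractional powers below are principal branches, and they are compatible with each other:
  \<open>csqrt z\<close> is \<open>exp (Ln z / 2)\<close> for \<open>z \<noteq> 0\<close>, including negative real \<open>z\<close>, where it lies off the
  branch cut of \<open>bessel_J \<nu>\<close>. Hence the fractional powers cancel for every \<open>z\<close>, and the literal
  formula is the entire function given by the power series in \<open>bessel_F_sums\<close> below.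
\<close>

definition bessel_F :: "real \<Rightarrow> complex \<Rightarrow> complex" where
  "bessel_F \<nu> z =
     of_real (2 powr \<nu> * Gamma (\<nu> - 1)) * z powr of_real (2 - \<nu> / 2)
       * (deriv ^^ 2) (bessel_J \<nu>) (csqrt z)"

definition starlike_fun :: "(complex \<Rightarrow> complex) \<Rightarrow> bool" where
  "starlike_fun f \<longleftrightarrow>
     f holomorphic_on ball 0 1 \<and> f 0 = 0 \<and> inj_on f (ball 0 1) \<and>
     (\<forall>w \<in> f ` ball 0 1. closed_segment 0 w \<subseteq> f ` ball 0 1)"

definition close_to_convex :: "(complex \<Rightarrow> complex) \<Rightarrow> bool" where
  "close_to_convex h \<longleftrightarrow>
     h holomorphic_on ball 0 1 \<and>
     (\<exists>\<phi>. \<phi> holomorphic_on ball 0 1 \<and> inj_on \<phi> (ball 0 1) \<and> convex (\<phi> ` ball 0 1) \<and>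
          (\<forall>z \<in> ball 0 1. Re (deriv h z / deriv \<phi> z) > 0))"

definition bessel_coeff :: "real \<Rightarrow> nat \<Rightarrow> complex" where
  "bessel_coeff \<nu> n = (-1) ^ n / of_real (fact n * Gamma (real n + \<nu> + 1) * 4 ^ n)"

lemma bessel_coeff_summable:
  assumes "\<nu> > 1"
  shows "summable (\<lambda>n. bessel_coeff \<nu> n * z ^ n)"
proof (rule summable_comparison_test')
  have G: "Gamma (\<nu> + 1) > 0" using assms by (intro Gamma_real_pos) auto
  show "summable (\<lambda>n. inverse (Gamma (\<nu> + 1)) * (inverse (fact n) * norm z ^ n))"
    by (intro summable_mult summable_exp)
  fix n :: nat
  have ni: "\<nu> + 1 \<notin> \<int>\<^sub>\<le>\<^sub>0" using assms by (auto elim!: nonpos_Ints_cases)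
  have "1 \<le> pochhammer (\<nu> + 1) n"
    unfolding pochhammer_prod using assms by (intro prod_ge_1) auto
  also have "\<dots> = Gamma (real n + \<nu> + 1) / Gamma (\<nu> + 1)"
    using pochhammer_Gamma[OF ni, of n] by (simp add: ac_simps)
  finally have le: "Gamma (\<nu> + 1) \<le> Gamma (real n + \<nu> + 1)" using G by (simp add: field_simps)
  have "Gamma (\<nu> + 1) * fact n \<le> fact n * Gamma (real n + \<nu> + 1) * 4 ^ n"
  proof -
    have "fact n * Gamma (\<nu> + 1) * 1 \<le> fact n * Gamma (real n + \<nu> + 1) * 4 ^ n"
      using le G by (intro mult_mono) auto
    thus ?thesis by (simp add: mult.commute)
  qed
  hence "inverse (fact n * Gamma (real n + \<nu> + 1) * 4 ^ n) \<le> inverse (Gamma (\<nu> + 1) * fact n)"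
    using G by (intro le_imp_inverse_le) auto
  moreover have "norm (bessel_coeff \<nu> n) = inverse (fact n * Gamma (real n + \<nu> + 1) * 4 ^ n)"
    unfolding bessel_coeff_def using le G
    by (simp only: norm_divide norm_power norm_minus_cancel norm_one norm_of_real power_one)
       (simp add: abs_mult field_simps)
  ultimately have "norm (bessel_coeff \<nu> n) \<le> inverse (Gamma (\<nu> + 1)) * inverse (fact n)"
    by simp
  hence "norm (bessel_coeff \<nu> n) * norm z ^ n
          \<le> (inverse (Gamma (\<nu> + 1)) * inverse (fact n)) * norm z ^ n"
    by (rule mult_right_mono) simp
  thus "norm (bessel_coeff \<nu> n * z ^ n)
          \<le> inverse (Gamma (\<nu> + 1)) * (inverse (fact n) * norm z ^ n)"
    by (simp add: norm_mult norm_power mult.assoc)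
qed

lemma bessel_J_sums:
  assumes "\<nu> > 1" "z \<noteq> 0"
  shows "bessel_J \<nu> z = (z / 2) powr of_real \<nu> * (\<Sum>n. bessel_coeff \<nu> n * (z\<^sup>2) ^ n)"
proof -
  have "(-1) ^ n / of_real (fact n * Gamma (real n + \<nu> + 1)) * (z / 2) powr of_real (2 * real n + \<nu>)
        = (z / 2) powr of_real \<nu> * (bessel_coeff \<nu> n * (z\<^sup>2) ^ n)" for n
  proof -
    have "(z / 2) powr of_real (2 * real n + \<nu>) = (z / 2) powr of_nat (2 * n) * (z / 2) powr of_real \<nu>"
      by (simp add: powr_add)
    also have "(z / 2) powr of_nat (2 * n) = (z\<^sup>2) ^ n / 4 ^ n"
      using assms(2) by (subst powr_nat') (auto simp: power_mult power_divide)
    finally show ?thesis by (simp add: bessel_coeff_def)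
  qed
  thus ?thesis unfolding bessel_J_def
    by (simp add: suminf_mult[OF bessel_coeff_summable[OF assms(1)]])
qed

lemma bessel_F_sums:
  assumes "\<nu> > 1"
  shows "(\<lambda>n. (-1) ^ n * of_real ((2 * real n + \<nu>) * (2 * real n + \<nu> - 1) * Gamma (\<nu> - 1)
                 / (fact n * Gamma (real n + \<nu> + 1) * 4 ^ n)) * z ^ (n + 1)) sums bessel_F \<nu> z"
proof (cases "z = 0")
  case True
  thus ?thesis by (simp add: bessel_F_def)
next
  case False
  define c where "c = bessel_coeff \<nu>"
  define g where "g d u = (\<Sum>n. (diffs ^^ d) c n * u ^ n)" for d and u :: complex
  have sm: "summable (\<lambda>n. (diffs ^^ d) c n * u ^ n)" for d u
  proof (induction d arbitrary: u)
    case 0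
    show ?case using bessel_coeff_summable[OF assms] by (simp add: c_def)
  next
    case (Suc d)
    show ?case using termdiff_converges_all[of "(diffs ^^ d) c" u] Suc by simp
  qed
  have g': "(g d has_field_derivative g (Suc d) u) (at u)" for d u
    using termdiffs_strong_converges_everywhere[OF sm, of d u] by (simp add: g_def[abs_def])
  define n2 where "n2 = complex_of_real \<nu>"
  define A where "A = (1 / 2 :: complex) powr n2"
  define S where "S = - (\<real>\<^sub>\<le>\<^sub>0 :: complex set)"
  have S: "open S" unfolding S_def using closed_nonpos_Reals_complex by blast
  have S0: "w \<noteq> 0" if "w \<in> S" for w using that by (auto simp: S_def)
  have J0: "bessel_J \<nu> w = A * (w powr n2 * g 0 (w\<^sup>2))" if "w \<in> S" for w
  proof -
    have "(w / 2) powr n2 = A * w powr n2"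
      using powr_times_real_left[of "1/2" w n2] unfolding A_def by simp
    thus ?thesis using bessel_J_sums[OF assms S0[OF that]] by (simp add: g_def c_def n2_def)
  qed
  have D: "((\<lambda>w. w powr a * g d (w\<^sup>2)) has_field_derivative
             a * w powr (a - 1) * g d (w\<^sup>2) + 2 * w powr (a + 1) * g (Suc d) (w\<^sup>2)) (at w)"
    if "w \<in> S" for a d w
  proof -
    have "w \<notin> \<real>\<^sub>\<le>\<^sub>0" using that by (auto simp: S_def)
    moreover have "((\<lambda>w. g d (w\<^sup>2)) has_field_derivative g (Suc d) (w\<^sup>2) * (2 * w)) (at w)"
      by (rule DERIV_chain2[OF g']) (auto intro!: derivative_eq_intros)
    ultimately show ?thesis using S0[OF that]
      by (auto intro!: derivative_eq_intros simp: powr_add)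
  qed
  have J1: "deriv (bessel_J \<nu>) w =
              A * (n2 * (w powr (n2 - 1) * g 0 (w\<^sup>2)) + 2 * (w powr (n2 + 1) * g 1 (w\<^sup>2)))"
    if "w \<in> S" for w
  proof -
    have "deriv (bessel_J \<nu>) w = deriv (\<lambda>w. A * (w powr n2 * g 0 (w\<^sup>2))) w"
      using J0 by (intro deriv_cong_ev refl eventually_mono[OF eventually_nhds_in_open[OF S that]])
    also have "\<dots> = A * (n2 * w powr (n2 - 1) * g 0 (w\<^sup>2) + 2 * w powr (n2 + 1) * g (Suc 0) (w\<^sup>2))"
      by (intro DERIV_imp_deriv DERIV_cmult D that)
    finally show ?thesis by (simp add: mult.assoc)
  qed
  have J2: "deriv (deriv (bessel_J \<nu>)) w =
              A * (n2 * ((n2 - 1) * w powr (n2 - 2) * g 0 (w\<^sup>2) + 2 * w powr n2 * g 1 (w\<^sup>2))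
                 + 2 * ((n2 + 1) * w powr n2 * g 1 (w\<^sup>2) + 2 * w powr (n2 + 2) * g 2 (w\<^sup>2)))"
    if "w \<in> S" for w
  proof -
    have "deriv (deriv (bessel_J \<nu>)) w =
            deriv (\<lambda>w. A * (n2 * (w powr (n2 - 1) * g 0 (w\<^sup>2))
                            + 2 * (w powr (n2 + 1) * g 1 (w\<^sup>2)))) w"
      using J1 by (intro deriv_cong_ev refl eventually_mono[OF eventually_nhds_in_open[OF S that]])
    also have "\<dots> = A * (n2 * ((n2 - 1) * w powr (n2 - 1 - 1) * g 0 (w\<^sup>2)
                                + 2 * w powr (n2 - 1 + 1) * g (Suc 0) (w\<^sup>2))
                 + 2 * ((n2 + 1) * w powr (n2 + 1 - 1) * g 1 (w\<^sup>2)
                        + 2 * w powr (n2 + 1 + 1) * g (Suc 1) (w\<^sup>2)))"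
      by (intro DERIV_imp_deriv DERIV_cmult DERIV_add D that)
    finally show ?thesis by (simp add: numeral_2_eq_2 add.commute)
  qed
  define s where "s = csqrt z"
  have s: "s \<in> S" "s\<^sup>2 = z" "s \<noteq> 0"
  proof -
    show s0: "s \<noteq> 0" "s\<^sup>2 = z" using False by (auto simp: s_def)
    have "Re s \<ge> 0" using csqrt_principal[of z] by (auto simp: s_def)
    moreover have "s \<notin> \<real>\<^sub>\<le>\<^sub>0"
      using csqrt_principal[of z] s0 unfolding s_def complex_nonpos_Reals_iff
      by (auto simp: complex_eq_iff)
    ultimately show "s \<in> S" by (simp add: S_def)
  qed
  have zs: "z powr of_real (2 - \<nu> / 2) = s ^ 4 / s powr n2"
  proof -
    have "s = exp (Ln z / 2)" unfolding s_def using False by (rule csqrt_exp_Ln)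
    moreover have "Im (Ln z / 2) \<le> pi" "- pi < Im (Ln z / 2)"
      using Im_Ln_le_pi[OF False] mpi_less_Im_Ln[OF False] pi_gt_zero
      unfolding Im_divide_numeral by linarith+
    ultimately have L: "Ln z = 2 * Ln s" by simp
    have "z powr of_real (2 - \<nu> / 2) = exp ((4 - n2) * Ln s)"
      using False by (simp add: powr_def L n2_def algebra_simps)
    also have "\<dots> = s powr (4 - n2)" using s(3) by (simp add: powr_def)
    also have "\<dots> = s powr 4 / s powr n2" by (simp add: powr_diff)
    also have "s powr 4 = s ^ 4" using powr_nat'[of s 4] s(3) by simp
    finally show ?thesis .
  qed
  have pn: "s powr n2 \<noteq> 0" using s(3) by simp
  have p2: "s powr (n2 - 2) = s powr n2 / z" "s powr (n2 + 2) = s powr n2 * z"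
    using powr_nat'[of s 2] s by (auto simp: powr_diff powr_add)
  have s4: "s ^ 4 = z * z"
    unfolding s(2)[symmetric] by (simp add: power2_eq_square eval_nat_numeral)
  have A: "complex_of_real (2 powr \<nu>) * A = 1"
  proof -
    have "A = of_real ((1 / 2) powr \<nu>)"
      unfolding A_def n2_def by (subst powr_of_real[symmetric]) auto
    thus ?thesis by (simp flip: of_real_mult powr_mult)
  qed
  define G where "G = complex_of_real (Gamma (\<nu> - 1))"
  have F: "bessel_F \<nu> z = G * (n2 * (n2 - 1) * (z * g 0 z) + (4 * n2 + 2) * (z ^ 2 * g 1 z)
                               + 4 * (z ^ 3 * g 2 z))"
  proof -
    have d2: "(deriv ^^ 2) (bessel_J \<nu>) s =
        A * (n2 * ((n2 - 1) * (s powr n2 / z) * g 0 z + 2 * s powr n2 * g 1 z)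
                 + 2 * ((n2 + 1) * s powr n2 * g 1 z + 2 * (s powr n2 * z) * g 2 z))"
      using J2[OF s(1)] unfolding s(2) p2 by (simp add: numeral_2_eq_2)
    have "bessel_F \<nu> z = of_real (2 powr \<nu>) * A * G *
        (z * z / s powr n2 * (n2 * ((n2 - 1) * (s powr n2 / z) * g 0 z + 2 * s powr n2 * g 1 z)
                 + 2 * ((n2 + 1) * s powr n2 * g 1 z + 2 * (s powr n2 * z) * g 2 z)))"
      unfolding bessel_F_def s_def[symmetric] zs d2 s4 by (simp add: G_def)
    also have "z * z / s powr n2 * (n2 * ((n2 - 1) * (s powr n2 / z) * g 0 z + 2 * s powr n2 * g 1 z)
                 + 2 * ((n2 + 1) * s powr n2 * g 1 z + 2 * (s powr n2 * z) * g 2 z))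
        = n2 * (n2 - 1) * (z * g 0 z) + (4 * n2 + 2) * (z ^ 2 * g 1 z) + 4 * (z ^ 3 * g 2 z)"
      using pn False by (simp add: field_simps power2_eq_square power3_eq_cube)
    finally show ?thesis unfolding A by simp
  qed
  have S0': "(\<lambda>n. c n * z ^ n) sums g 0 z"
    using sm[of 0 z] by (simp add: g_def summable_sums)
  have S1: "(\<lambda>n. of_nat n * c n * z ^ n) sums (z * g 1 z)"
  proof -
    have "(\<lambda>n. z * (diffs c n * z ^ n)) sums (z * g 1 z)"
      using sm[of 1 z] by (intro sums_mult) (simp add: g_def summable_sums)
    hence "(\<lambda>n. of_nat (Suc n) * c (Suc n) * z ^ Suc n) sums (z * g 1 z)"
      by (simp add: diffs_def mult_ac)
    from this[THEN sums_Suc_iff[THEN iffD1, of "\<lambda>n. of_nat n * c n * z ^ n"]]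
    show ?thesis by simp
  qed
  have S2: "(\<lambda>n. of_nat n * (of_nat n - 1) * c n * z ^ n) sums (z\<^sup>2 * g 2 z)"
  proof -
    have "(\<lambda>n. z\<^sup>2 * ((diffs ^^ 2) c n * z ^ n)) sums (z\<^sup>2 * g 2 z)"
      using sm[of 2 z] by (intro sums_mult) (simp add: g_def summable_sums)
    moreover have "z\<^sup>2 * ((diffs ^^ 2) c n * z ^ n)
        = of_nat (n + 2) * (of_nat (n + 2) - 1) * c (n + 2) * z ^ (n + 2)" for n
      by (simp add: diffs_def numeral_2_eq_2 algebra_simps)
    ultimately have "(\<lambda>n. of_nat (n + 2) * (of_nat (n + 2) - 1) * c (n + 2) * z ^ (n + 2))
                       sums (z\<^sup>2 * g 2 z)"
      by simp
    thus ?thesis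
      by (subst (asm) sums_iff_shift) (simp add: numeral_2_eq_2)
  qed
  have "(\<lambda>n. G * z * (n2 * (n2 - 1) * (c n * z ^ n) + (4 * n2 + 2) * (of_nat n * c n * z ^ n)
              + 4 * (of_nat n * (of_nat n - 1) * c n * z ^ n)))
        sums (G * z * (n2 * (n2 - 1) * g 0 z + (4 * n2 + 2) * (z * g 1 z) + 4 * (z\<^sup>2 * g 2 z)))"
    by (intro sums_mult sums_add S0' S1 S2)
  also have "G * z * (n2 * (n2 - 1) * g 0 z + (4 * n2 + 2) * (z * g 1 z) + 4 * (z\<^sup>2 * g 2 z))
             = bessel_F \<nu> z"
    unfolding F by (simp add: algebra_simps power2_eq_square power3_eq_cube)
  also have "(\<lambda>n. G * z * (n2 * (n2 - 1) * (c n * z ^ n) + (4 * n2 + 2) * (of_nat n * c n * z ^ n)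
              + 4 * (of_nat n * (of_nat n - 1) * c n * z ^ n)))
      = (\<lambda>n. (2 * of_nat n + n2) * (2 * of_nat n + n2 - 1) * G * c n * z ^ (n + 1))"
    by (rule ext) (simp add: algebra_simps)
  also have "\<dots> = (\<lambda>n. (-1) ^ n * of_real ((2 * real n + \<nu>) * (2 * real n + \<nu> - 1) * Gamma (\<nu> - 1)
                 / (fact n * Gamma (real n + \<nu> + 1) * 4 ^ n)) * z ^ (n + 1))"
    by (rule ext) (simp add: c_def bessel_coeff_def G_def n2_def)
  finally show ?thesis .
qed

end

theory Submission
  imports Defs
begin

text \<open>
  Write \<open>F = bessel_F \<nu>\<close> as \<open>\<Sum>n. (-1)^n * b n * z^(n+1)\<close> with positive \<open>b n = F_coeff \<nu> n\<close> and
  \<open>b 0 = 1\<close>. For every \<open>\<nu> > 1\<close> the coefficients decay so fast that beyond the first two of them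
  only crude bounds matter. Two consequences of the ratio bound \<open>F_coeff_ratio\<close> are used throughout:
  in the series of \<open>(deriv ^^ m) F\<close> with \<open>m \<ge> 2\<close> each coefficient is at most \<open>5/12\<close> times the
  preceding one, and \<open>\<Sum>n\<ge>2. n\<^sup>2 * (n + 1) * b n \<le> 35/18 * b 1 < 2 * b 1\<close>.

  The first consequence makes \<open>(deriv ^^ m) F\<close>, \<open>m \<ge> 2\<close>, differ from its value \<open>c\<close> at the
  origin by less than \<open>\<bar>c\<bar>\<close> on the disk. Hence the derivatives of \<open>F\<close> of every order \<open>m \<ge> 1\<close> are
  univalent and close-to-convex with respect to the linear map \<open>z \<mapsto> c * z\<close>, whatever \<open>\<nu> > 1\<close> is, and
  the critical order is decided by starlikeness alone.

  Starlikeness is equivalent to \<open>F'(1) \<ge> 0\<close> (\<open>starlike_bessel_F_iff\<close>). If \<open>F'(1) < 0\<close>, then \<open>F'\<close>,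
  which is \<open>1\<close> at the origin, has a zero on \<open>(0, 1)\<close>, and \<open>F\<close> is not univalent. Conversely let
  \<open>F'(1) \<ge> 0\<close>, \<open>z\<close> be in the disk, \<open>r = \<bar>z\<bar>\<close> and \<open>G = F / z\<close>. The linear terms of \<open>F'\<close> and \<open>G\<close> are
  negative and, by the second consequence, dominate the rest: passing from \<open>r\<close> to \<open>z\<close> along the circle
  does not decrease the real parts of \<open>F'\<close> and \<open>G\<close>, and the two increments are nearly parallel. So
  \<open>Re (F'(z) * cnj (G z)) \<ge> F'(r) * G r > 0\<close> and \<open>Re (F'(z)) \<ge> F'(r) > 0\<close>. The second inequality
  gives univalence, the first one is \<open>Re (z * F'(z) / F z) > 0\<close>, and both together give a starlike
  image.

  It remains to study \<open>F'(1)\<close> as a function of \<open>\<nu>\<close>. A telescoping rearrangement of its series expresses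
  it as a positive multiple of \<open>(2\<nu>\<^sup>2 - 2\<nu> - 3) J\<^sub>\<nu>(1) - (\<nu>\<^sup>2 + \<nu> - 3) J\<^sub>\<nu>\<^sub>+\<^sub>1(1)\<close>
  (\<open>deriv_bessel_F_1_eq_bessel_J\<close>). The product \<open>\<nu> * (\<nu> - 1) * F'(1)\<close> equals
  \<open>\<nu>\<^sup>2 - 3/2 * \<nu> - 1\<close> plus a series whose increments are small against those of this polynomial, so it is
  continuous and strictly increasing (\<open>scaled_deriv_at_1_increment\<close>); a four-term approximation shows that it changes sign
  between \<open>1.90425\<close> and \<open>1.906\<close>. Its zero is the critical order.
\<close>

section \<open>Criteria for starlike and close-to-convex functions\<close>

text \<open>
  Lifting the ray from \<open>f z0\<close> towards the origin back through \<open>f\<close> gives a curve whose modulus shrinks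
  along with the ray, because \<open>\<bar>z\<bar>\<^sup>2\<close> has derivative \<open>2 / t * \<bar>z\<bar>\<^sup>2 * Re (f z / (z * f' z))\<close> at
  \<open>f z = t * f z0\<close>. Instead of following this curve, the proof takes the supremum \<open>s\<close> of the
  parameters at which the ray is outside \<open>f ` cball 0 \<bar>z0\<bar>\<close>, and shows that just below \<open>s\<close> the
  inverse of \<open>f\<close> still takes values in that disk.
\<close>
lemma starlike_funI:
  assumes hol: "f holomorphic_on ball 0 1" and f0: "f 0 = 0" and inj: "inj_on f (ball 0 1)"
    and pos: "\<And>z. z \<in> ball 0 1 \<Longrightarrow> z \<noteq> 0 \<Longrightarrow> Re (z * deriv f z * cnj (f z)) > 0"
  shows "starlike_fun f"
proof -
  have "t *\<^sub>R f z0 \<in> f ` ball 0 1" if z0: "z0 \<in> ball 0 1" and t: "0 \<le> t" "t \<le> 1" for z0 t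
  proof (rule ccontr)
    assume out: "t *\<^sub>R f z0 \<notin> f ` ball 0 1"
    define w0 where "w0 = f z0"
    define K where "K = cball (0 :: complex) (norm z0)"
    have KB: "K \<subseteq> ball 0 1" using z0 by (auto simp: K_def)
    obtain g where g: "g holomorphic_on (f ` ball 0 1)"
      "\<And>z. z \<in> ball 0 1 \<Longrightarrow> deriv f z * deriv g (f z) = 1"
      "\<And>z. z \<in> ball 0 1 \<Longrightarrow> g (f z) = z"
      using holomorphic_has_inverse[OF hol open_ball inj] by blast
    have op: "open (f ` ball 0 1)" using open_mapping_thm3[OF hol open_ball inj] .
    have cK: "closed (f ` K)"
      unfolding K_def by (intro compact_imp_closed compact_continuous_image
          holomorphic_on_imp_continuous_on holomorphic_on_subset[OF hol])
         (use KB in \<open>auto simp: K_def\<close>)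
    define T where "T = {t \<in> {0..1}. t *\<^sub>R w0 \<notin> f ` K}"
    have tT: "t \<in> T" using out t KB by (auto simp: T_def w0_def)
    define s where "s = Sup T"
    have bdd: "bdd_above T" unfolding T_def by (rule bdd_aboveI[of _ 1]) auto
    have ts: "t \<le> s" unfolding s_def by (rule cSup_upper[OF tT bdd])
    have s1: "s \<le> 1" unfolding s_def using tT by (intro cSup_least) (auto simp: T_def)
    have sK: "s *\<^sub>R w0 \<in> f ` K"
    proof (rule ccontr)
      assume n: "s *\<^sub>R w0 \<notin> f ` K"
      have "s \<noteq> 1" using n by (auto simp: w0_def K_def)
      have "open ((\<lambda>x. x *\<^sub>R w0) -` (- f ` K))"
        using cK by (intro open_vimage continuous_intros) auto
      then obtain e where e: "e > 0" "ball s e \<subseteq> (\<lambda>x. x *\<^sub>R w0) -` (- f ` K)"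
        using n unfolding open_contains_ball by (metis ComplI vimageI)
      \<comment> \<open>The complement of the compact image is open, so the ray would still be outside beyond \<open>s\<close>.\<close>
      define x where "x = min 1 (s + e / 2)"
      have "x \<in> ball s e" using s1 \<open>e > 0\<close> by (auto simp: x_def dist_real_def min_def)
      hence "x \<in> T" using e(2) ts t s1 \<open>e > 0\<close> by (auto simp: T_def x_def)
      hence "x \<le> s" unfolding s_def by (rule cSup_upper[OF _ bdd])
      thus False using s1 \<open>s \<noteq> 1\<close> \<open>e > 0\<close> by (auto simp: x_def min_def split: if_splits)
    qed
    then obtain z1 where z1: "z1 \<in> K" "f z1 = s *\<^sub>R w0" by auto
    have z1B: "z1 \<in> ball 0 1" using z1 KB by auto
    have "s \<noteq> 0"
    proof
      assume "s = 0"
      hence "t = 0" using ts t by simp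
      moreover have "0 \<in> f ` K" using f0 by (force simp: K_def image_iff)
      ultimately show False using tT by (simp add: T_def)
    qed
    hence s0: "s > 0" using ts t by simp
    have "w0 \<noteq> 0"
    proof
      assume "w0 = 0"
      moreover have "0 \<in> f ` K" using f0 by (force simp: K_def image_iff)
      ultimately show False using tT by (simp add: T_def)
    qed
    have "z1 \<noteq> 0" using z1 f0 s0 \<open>w0 \<noteq> 0\<close> by auto
    define \<zeta> where "\<zeta> = (\<lambda>x. g (x *\<^sub>R w0))"
    have gd: "(g has_field_derivative deriv g (s *\<^sub>R w0)) (at (s *\<^sub>R w0))"
      using g(1) op z1 z1B by (metis holomorphic_derivI imageI)
    have \<zeta>d: "(\<zeta> has_vector_derivative w0 * deriv g (f z1)) (at s)"
    proof -
      have "((\<lambda>x. x *\<^sub>R w0) has_vector_derivative w0) (at s)"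
        unfolding has_vector_derivative_def by (auto intro!: derivative_eq_intros)
      from field_vector_diff_chain_at[OF this gd] show ?thesis
        by (simp add: \<zeta>_def o_def z1(2))
    qed
    have \<zeta>s: "\<zeta> s = z1" using g(3)[OF z1B] z1 by (simp add: \<zeta>_def)
    \<comment> \<open>The squared modulus of the lifted ray increases through \<open>s\<close>.\<close>
    have D: "((\<lambda>x. (Re (\<zeta> x))\<^sup>2 + (Im (\<zeta> x))\<^sup>2) has_real_derivative
            2 * Re (w0 * deriv g (f z1) * cnj z1)) (at s)"
    proof -
      have "((\<lambda>x. Re (\<zeta> x)) has_real_derivative Re (w0 * deriv g (f z1))) (at s)"
           "((\<lambda>x. Im (\<zeta> x)) has_real_derivative Im (w0 * deriv g (f z1))) (at s)"
        unfolding has_real_derivative_iff_has_vector_derivative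
        using bounded_linear.has_vector_derivative[OF bounded_linear_Re \<zeta>d]
              bounded_linear.has_vector_derivative[OF bounded_linear_Im \<zeta>d] .
      from DERIV_add[OF DERIV_power[OF this(1), of 2] DERIV_power[OF this(2), of 2]]
      show ?thesis by (simp add: \<zeta>s algebra_simps)
    qed
    have "Re (w0 * deriv g (f z1) * cnj z1) > 0"
    proof -
      define d where "d = deriv f z1"
      have d0: "d \<noteq> 0" using g(2)[OF z1B] by (auto simp: d_def)
      hence dg: "deriv g (f z1) = 1 / d"
        using g(2)[OF z1B] by (simp add: d_def eq_divide_eq mult.commute)
      have "f z1 / d * cnj z1 = of_real s * (w0 * deriv g (f z1) * cnj z1)"
        unfolding dg by (simp add: z1(2) scaleR_conv_of_real)
      moreover have "Re (of_real s * X) = s * Re X" for X by simp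
      ultimately have "Re (w0 * deriv g (f z1) * cnj z1) = Re (f z1 / d * cnj z1) / s"
        using s0 by (simp only:) simp
      also have "f z1 / d * cnj z1 = cnj (z1 * d * cnj (f z1)) / of_real ((norm d)\<^sup>2)"
        unfolding complex_norm_square using d0 by simp
      also have "Re \<dots> = Re (z1 * d * cnj (f z1)) / (norm d)\<^sup>2"
        by (simp only: Re_divide_of_real complex_cnj_cnj cnj.simps)
      finally show ?thesis using pos[OF z1B \<open>z1 \<noteq> 0\<close>] s0 d0 by (simp add: d_def)
    qed
    hence "2 * Re (w0 * deriv g (f z1) * cnj z1) > 0" by (rule mult_pos_pos[OF zero_less_numeral])
    from DERIV_pos_inc_left[OF D this] obtain \<delta> where \<delta>: "\<delta> > 0" "\<And>h. 0 < h \<Longrightarrow> h < \<delta> \<Longrightarrow>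
        (Re (\<zeta> (s - h)))\<^sup>2 + (Im (\<zeta> (s - h)))\<^sup>2 < (Re (\<zeta> s))\<^sup>2 + (Im (\<zeta> s))\<^sup>2"
      by blast
    have "open ((\<lambda>x. x *\<^sub>R w0) -` (f ` ball 0 1))"
      using op by (intro open_vimage continuous_intros) auto
    moreover have "s \<in> (\<lambda>x. x *\<^sub>R w0) -` (f ` ball 0 1)"
      using z1(2) z1B by (metis imageI vimageI)
    ultimately obtain e where e: "e > 0" "ball s e \<subseteq> (\<lambda>x. x *\<^sub>R w0) -` (f ` ball 0 1)"
      by (meson open_contains_ball)
    have inK: "x *\<^sub>R w0 \<in> f ` K" if x: "s - min \<delta> e < x" "x \<le> s" for x
    proof (cases "x = s")
      case False
      have "x \<in> ball s e" using x by (auto simp: dist_real_def)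
      then obtain z where z: "z \<in> ball 0 1" "f z = x *\<^sub>R w0" using e(2) by auto
      have "\<zeta> x = z" using g(3)[OF z(1)] z by (simp add: \<zeta>_def)
      hence "(norm z)\<^sup>2 < (norm z1)\<^sup>2" using \<delta>(2)[of "s - x"] x False \<zeta>s by (simp add: cmod_power2)
      hence "norm z < norm z1" by (rule power2_less_imp_less) simp
      hence "z \<in> K" using z1 by (auto simp: K_def)
      thus ?thesis using z by (metis imageI)
    qed (use sK in simp)
    \<comment> \<open>Hence no point of \<open>T\<close> lies within \<open>min \<delta> e\<close> below its supremum.\<close>
    have "y \<le> s - min \<delta> e" if "y \<in> T" for y
    proof (rule ccontr)
      assume "\<not> y \<le> s - min \<delta> e"
      moreover have "y \<le> s" unfolding s_def by (rule cSup_upper[OF that bdd])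
      ultimately show False using inK[of y] that by (auto simp: T_def)
    qed
    hence "s \<le> s - min \<delta> e" unfolding s_def using tT by (intro cSup_least) (auto simp: s_def)
    thus False using \<delta> e by simp
  qed
  thus ?thesis unfolding starlike_fun_def using hol f0 inj
    by (auto simp: in_segment)
qed

text \<open>
  The Noshiro--Warschawski criterion: on a segment \<open>[w, z]\<close> the real part of \<open>f / (z - w)\<close> has
  derivative \<open>Re f'\<close> and therefore increases.
\<close>
lemma inj_on_of_Re_deriv_pos:
  assumes "convex S" "\<And>z. z \<in> S \<Longrightarrow> (f has_field_derivative f' z) (at z)"
    and "\<And>z. z \<in> S \<Longrightarrow> Re (f' z) > 0"
  shows "inj_on f S"
proof (rule inj_onI, rule ccontr)
  fix z w assume zw: "z \<in> S" "w \<in> S" "f z = f w" "z \<noteq> w"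
  have sub: "closed_segment w z \<subseteq> S" using assms(1) zw by (simp add: closed_segment_subset)
  have "((\<lambda>u. f u / (z - w)) has_field_derivative f' u / (z - w)) (at u)" if "u \<in> closed_segment w z" for u
    using assms(2) sub that by (intro DERIV_cdivide) auto
  from complex_mvt_line[OF this, of w z] obtain u where
    "u \<in> closed_segment w z" "Re (f z / (z - w)) - Re (f w / (z - w)) = Re (f' u / (z - w) * (z - w))" by auto
  thus False using zw sub assms(3)[of u] by auto
qed

text \<open>
  The comparison map is \<open>\<phi> z = c * z\<close>; the hypothesis places \<open>h' / c\<close> in the disk of radius one
  around one, which lies in the right half-plane.
\<close>
lemma near_linear_close_to_convex:
  assumes d: "\<And>z. z \<in> ball 0 1 \<Longrightarrow> (h has_field_derivative h' z) (at z)"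
    and near: "\<And>z. z \<in> ball 0 1 \<Longrightarrow> norm (h' z - c) < norm c"
  shows "close_to_convex h" "inj_on h (ball 0 1)"
proof -
  have c0: "c \<noteq> 0" using near[of 0] by (auto simp del: norm_ge_zero simp: not_less[symmetric])
  have Re: "Re (h' z / c) > 0" if "z \<in> ball 0 1" for z
  proof -
    have "h' z / c - 1 = (h' z - c) / c" using c0 by (simp add: diff_divide_distrib)
    hence "norm (h' z / c - 1) < 1"
      using near[OF that] c0 by (simp add: norm_divide)
    moreover have "\<bar>Re (h' z / c - 1)\<bar> \<le> norm (h' z / c - 1)" by (rule abs_Re_le_cmod)
    ultimately show ?thesis by simp
  qed
  have hol: "h holomorphic_on ball 0 1"
    unfolding holomorphic_on_open[OF open_ball] using d by blast
  have dh: "deriv h z = h' z" if "z \<in> ball 0 1" for z using d[OF that] by (rule DERIV_imp_deriv)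
  have "deriv ((*) c) z = c" for z
    by (rule DERIV_imp_deriv) (auto intro!: derivative_eq_intros)
  moreover have "convex ((*) c ` ball 0 1)"
    by (intro convex_linear_image convex_ball) (simp add: linear_iff algebra_simps)
  moreover have "inj_on ((*) c) (ball 0 1)" using c0 by (auto simp: inj_on_def)
  ultimately show "close_to_convex h" unfolding close_to_convex_def using Re dh hol
    by (intro conjI exI[of _ "(*) c"]) (auto intro!: holomorphic_intros)
  have "inj_on (\<lambda>z. h z / c) (ball 0 1)"
    by (rule inj_on_of_Re_deriv_pos[OF convex_ball _ Re]) (auto intro!: DERIV_cdivide d)
  thus "inj_on h (ball 0 1)" using c0 by (auto simp: inj_on_def)
qed

section \<open>Power series on the closed unit disk\<close>

lemma entire_series_higher_deriv:
  fixes c :: "nat \<Rightarrow> complex"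
  assumes "\<And>z. (\<lambda>n. c n * z ^ n) sums f z"
  shows "(\<lambda>n. fact (n + m) / fact n * c (n + m) * z ^ n) sums (deriv ^^ m) f z"
    and "((deriv ^^ m) f has_field_derivative (deriv ^^ Suc m) f z) (at z)"
proof -
  have *: "(\<lambda>n. fact (n + m) / fact n * c (n + m) * z ^ n) sums (deriv ^^ m) f z
      \<and> ((deriv ^^ m) f has_field_derivative (deriv ^^ Suc m) f z) (at z)" for z
  proof (induction m arbitrary: z)
    case 0
    have f: "f = (\<lambda>z. \<Sum>n. c n * z ^ n)" using assms by (auto simp: sums_iff)
    have "(f has_field_derivative (\<Sum>n. diffs c n * z ^ n)) (at z)" 
      unfolding f using assms by (intro termdiffs_strong_converges_everywhere) (auto simp: sums_iff)
    thus ?case using assms by (auto simp: DERIV_imp_deriv)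
  next
    case (Suc m)
    define d where "d = (\<lambda>n. fact (n + m) / fact n * c (n + m))"
    have dd: "diffs d = (\<lambda>n. fact (n + Suc m) / fact n * c (n + Suc m))"
      using of_nat_neq_0[where 'a = complex]
      by (intro ext) (simp add: diffs_def d_def divide_simps del: of_nat_Suc)
    have f: "(deriv ^^ m) f = (\<lambda>z. \<Sum>n. d n * z ^ n)" using Suc by (auto simp: sums_iff d_def)
    have sm: "summable (\<lambda>n. d n * z ^ n)" for z using Suc by (auto simp: sums_iff d_def)
    have sm': "summable (\<lambda>n. diffs d n * z ^ n)" for z by (rule termdiff_converges_all[OF sm])
    have "((deriv ^^ m) f has_field_derivative (\<Sum>n. diffs d n * z ^ n)) (at z)" for z
      unfolding f by (intro termdiffs_strong_converges_everywhere sm)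
    hence f': "(deriv ^^ Suc m) f = (\<lambda>z. \<Sum>n. diffs d n * z ^ n)"
      by (auto simp: DERIV_imp_deriv)
    have "((deriv ^^ Suc m) f has_field_derivative (\<Sum>n. diffs (diffs d) n * z ^ n)) (at z)"
      unfolding f' by (intro termdiffs_strong_converges_everywhere sm')
    moreover from this have "(deriv ^^ Suc (Suc m)) f z = (\<Sum>n. diffs (diffs d) n * z ^ n)"
      using DERIV_imp_deriv by simp
    moreover have "(\<lambda>n. diffs d n * z ^ n) sums (deriv ^^ Suc m) f z"
      unfolding f' using sm' by (rule summable_sums)
    ultimately show ?case unfolding dd by simp
  qed
  show "(\<lambda>n. fact (n + m) / fact n * c (n + m) * z ^ n) sums (deriv ^^ m) f z"
    and "((deriv ^^ m) f has_field_derivative (deriv ^^ Suc m) f z) (at z)" using * by auto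
qed

text \<open>
  On the unit circle \<open>1 - Re v = \<bar>v - 1\<bar>\<^sup>2 / 2\<close>, which turns the first-order estimate
  \<open>\<bar>w^n - 1\<bar> \<le> n * \<bar>w - 1\<bar>\<close> into a second-order one. In polar coordinates the statement is
  \<open>1 - cos (n\<theta>) \<le> n\<^sup>2 * (1 - cos \<theta>)\<close>.
\<close>
lemma Re_power_diff_le:
  assumes "norm z = r"
  shows "\<bar>Re (z ^ n) - r ^ n\<bar> \<le> (real n)\<^sup>2 * r ^ (n - 1) * (r - Re z)"
proof (cases "r = 0 \<or> n = 0")
  case False
  hence r: "r > 0" and n: "n > 0" using assms by auto
  define w where "w = z / of_real r"
  have z: "z = of_real r * w" using r by (simp add: w_def)
  have w1: "norm w = 1" using assms r by (simp add: w_def norm_divide)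
  have half: "1 - Re v = (norm (v - 1))\<^sup>2 / 2" if "norm v = 1" for v
  proof -
    have "(Re v)\<^sup>2 + (Im v)\<^sup>2 = 1" using that by (metis cmod_power2 power_one)
    thus ?thesis by (simp add: cmod_power2) (simp add: power2_eq_square algebra_simps)
  qed
  have w1n: "norm (w ^ n) = 1" using w1 by (simp add: norm_power)
  have "norm (w ^ n - 1) \<le> real n * norm (w - 1)" using norm_power_diff[of w 1 n] w1 by simp
  hence "(norm (w ^ n - 1))\<^sup>2 \<le> (real n * norm (w - 1))\<^sup>2" by (intro power_mono) auto
  hence "1 - Re (w ^ n) \<le> (real n)\<^sup>2 * (1 - Re w)"
    unfolding half[OF w1] half[OF w1n] by (simp add: power_mult_distrib)
  hence "r ^ n * (1 - Re (w ^ n)) \<le> r ^ n * ((real n)\<^sup>2 * (1 - Re w))" using r by (intro mult_left_mono) auto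
  also have "\<dots> = (real n)\<^sup>2 * r ^ (n - 1) * (r - Re z)"
    using n by (cases n) (auto simp: z algebra_simps)
  finally have "r ^ n - Re (z ^ n) \<le> (real n)\<^sup>2 * r ^ (n - 1) * (r - Re z)"
    by (simp add: z power_mult_distrib right_diff_distrib flip: of_real_power)
  moreover have "Re (z ^ n) \<le> r ^ n" using complex_Re_le_cmod[of "z ^ n"] assms by (simp add: norm_power)
  ultimately show ?thesis by simp
qed (use assms in \<open>auto simp: zero_power\<close>)

lemma series_increment:
  fixes u :: "nat \<Rightarrow> real" and U :: "complex \<Rightarrow> complex"
  assumes U: "\<And>z. (\<lambda>n. of_real (u n) * z ^ n) sums U z"
    and sm: "summable (\<lambda>n. real (n + 2) * \<bar>u (n + 2)\<bar>)" and z: "norm z \<le> 1" "norm w \<le> 1"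
  shows "norm (U z - U w - of_real (u 1) * (z - w)) \<le> norm (z - w) * (\<Sum>n. real (n + 2) * \<bar>u (n + 2)\<bar>)"
proof -
  have "(\<lambda>n. of_real (u n) * (z ^ n - w ^ n)) sums (U z - U w)"
    using sums_diff[OF U[of z] U[of w]] by (simp add: algebra_simps)
  hence *: "(\<lambda>n. of_real (u (n + 2)) * (z ^ (n + 2) - w ^ (n + 2))) sums (U z - U w - of_real (u 1) * (z - w))"
    by (subst (asm) sums_iff_shift'[of _ 2, symmetric]) (simp add: numeral_2_eq_2)
  have le: "norm (of_real (u (n + 2)) * (z ^ (n + 2) - w ^ (n + 2))) \<le> norm (z - w) * (real (n + 2) * \<bar>u (n + 2)\<bar>)" for n
    using mult_left_mono[OF norm_power_diff[OF z, of "n + 2"], of "\<bar>u (n + 2)\<bar>"] by (simp add: norm_mult mult_ac)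
  have "norm (U z - U w - of_real (u 1) * (z - w)) \<le> (\<Sum>n. norm (z - w) * (real (n + 2) * \<bar>u (n + 2)\<bar>))"
    by (rule norm_sums_le[OF * summable_sums le]) (rule summable_mult[OF sm])
  thus ?thesis using sm by (simp add: suminf_mult)
qed

text \<open>
  A bound of second order: near \<open>z = r\<close> the quantity \<open>r - Re z\<close> is quadratically smaller than
  \<open>\<bar>z - r\<bar>\<close>. The previous estimate would be too weak for the real parts of the increments.
\<close>
lemma series_Re_increment:
  fixes u :: "nat \<Rightarrow> real" and U :: "complex \<Rightarrow> complex"
  assumes U: "\<And>z. (\<lambda>n. of_real (u n) * z ^ n) sums U z"
    and sm: "summable (\<lambda>n. (real (n + 2))\<^sup>2 * \<bar>u (n + 2)\<bar>)" and z: "norm z = r" "r \<le> 1"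
  shows "\<bar>Re (U z - U (of_real r)) + u 1 * (r - Re z)\<bar> \<le> (r - Re z) * (\<Sum>n. (real (n + 2))\<^sup>2 * \<bar>u (n + 2)\<bar>)"
proof -
  have r0: "r \<ge> 0" using z by auto
  have rz: "r - Re z \<ge> 0" using complex_Re_le_cmod[of z] z by simp
  have "(\<lambda>n. of_real (u n) * (z ^ n - of_real r ^ n)) sums (U z - U (of_real r))"
    using sums_diff[OF U[of z] U[of "of_real r"]] by (simp add: algebra_simps)
  from sums_Re[OF this] have "(\<lambda>n. u n * (Re (z ^ n) - r ^ n)) sums Re (U z - U (of_real r))"
    by (simp flip: of_real_power)
  hence *: "(\<lambda>n. u (n + 2) * (Re (z ^ (n + 2)) - r ^ (n + 2))) sums (Re (U z - U (of_real r)) + u 1 * (r - Re z))"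
    by (subst (asm) sums_iff_shift'[of _ 2, symmetric]) (simp add: numeral_2_eq_2 algebra_simps)
  have le: "norm (u (n + 2) * (Re (z ^ (n + 2)) - r ^ (n + 2))) \<le> (r - Re z) * ((real (n + 2))\<^sup>2 * \<bar>u (n + 2)\<bar>)" for n
  proof -
    have "\<bar>Re (z ^ (n + 2)) - r ^ (n + 2)\<bar> \<le> (real (n + 2))\<^sup>2 * r ^ (n + 2 - 1) * (r - Re z)"
      by (rule Re_power_diff_le[OF z(1)])
    also have "\<dots> \<le> (real (n + 2))\<^sup>2 * 1 * (r - Re z)"
      using z r0 rz by (intro mult_right_mono mult_left_mono power_le_one) auto
    finally have "\<bar>Re (z ^ (n + 2)) - r ^ (n + 2)\<bar> \<le> (real (n + 2))\<^sup>2 * (r - Re z)" by simp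
    from mult_left_mono[OF this, of "\<bar>u (n + 2)\<bar>"] show ?thesis by (simp add: abs_mult mult_ac)
  qed
  have "norm (Re (U z - U (of_real r)) + u 1 * (r - Re z)) \<le> (\<Sum>n. (r - Re z) * ((real (n + 2))\<^sup>2 * \<bar>u (n + 2)\<bar>))"
    by (rule norm_sums_le[OF * summable_sums le]) (rule summable_mult[OF sm])
  thus ?thesis using sm by (simp add: suminf_mult)
qed

lemma Re_mult_cnj_expand:
  "Re ((complex_of_real p + a) * cnj (of_real g + b)) = p * g + p * Re b + g * Re a + Re (a * cnj b)"
  by (simp add: algebra_simps)

text \<open>
  The vectors \<open>-2bd\<close> and \<open>-bd\<close> point in the same direction; the admissible errors are just small
  enough to keep the angle between the perturbed vectors at most a right angle, since
  \<open>2 - 2/3 - 1 - 1/3 = 0\<close>.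
\<close>
lemma Re_mult_cnj_near_parallel_nonneg:
  fixes d e1 e2 :: complex
  assumes "b \<ge> 0" "norm e1 \<le> b * norm d" "norm e2 \<le> b / 3 * norm d"
  shows "Re ((e1 - of_real (2 * b) * d) * cnj (e2 - of_real b * d)) \<ge> 0"
proof -
  define D where "D = norm d"
  have D: "D \<ge> 0" by (simp add: D_def)
  have "(e1 - of_real (2 * b) * d) * cnj (e2 - of_real b * d)
      = of_real (2 * b\<^sup>2) * (d * cnj d) - of_real (2 * b) * (d * cnj e2) - of_real b * (e1 * cnj d) + e1 * cnj e2"
    by (simp add: algebra_simps power2_eq_square)
  also have "d * cnj d = of_real (D\<^sup>2)" by (simp only: D_def complex_norm_square)
  finally have "Re ((e1 - of_real (2 * b) * d) * cnj (e2 - of_real b * d))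
     = 2 * b\<^sup>2 * D\<^sup>2 - 2 * b * Re (d * cnj e2) - b * Re (e1 * cnj d) + Re (e1 * cnj e2)"
    by (simp only: minus_complex.sel plus_complex.sel Re_complex_of_real flip: of_real_mult)
       (simp add: algebra_simps)
  moreover have "Re (d * cnj e2) \<le> D * (b / 3 * D)"
    using complex_Re_le_cmod[of "d * cnj e2"] mult_left_mono[OF assms(3) D]
    by (simp add: norm_mult D_def)
  moreover have "Re (e1 * cnj d) \<le> b * D * D"
    using complex_Re_le_cmod[of "e1 * cnj d"] mult_right_mono[OF assms(2) D]
    by (simp add: norm_mult D_def)
  moreover have "Re (e1 * cnj e2) \<ge> - (b * D * (b / 3 * D))"
    using abs_Re_le_cmod[of "e1 * cnj e2"] mult_mono[OF assms(2,3)] assms(1) D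
    by (simp add: norm_mult D_def abs_le_iff)
  ultimately have "Re ((e1 - of_real (2 * b) * d) * cnj (e2 - of_real b * d))
     \<ge> 2 * b\<^sup>2 * D\<^sup>2 - 2 * b * (D * (b / 3 * D)) - b * (b * D * D) - b * D * (b / 3 * D)"
    using mult_left_mono[of "Re (d * cnj e2)" "D * (b / 3 * D)" "2 * b"] assms(1)
      mult_left_mono[of "Re (e1 * cnj d)" "b * D * D" b] by linarith
  also have "2 * b\<^sup>2 * D\<^sup>2 - 2 * b * (D * (b / 3 * D)) - b * (b * D * D) - b * D * (b / 3 * D) = 0"
    by (simp add: power2_eq_square)
  finally show ?thesis by simp
qed

section \<open>The coefficients and their decay\<close>

text \<open>
  The quotient \<open>Gamma (\<nu> - 1) / Gamma (n + \<nu> + 1)\<close> is written as a Pochhammer symbol, so that every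
  coefficient is a rational function of \<open>\<nu>\<close>.
\<close>
definition F_coeff :: "real \<Rightarrow> nat \<Rightarrow> real" where
  "F_coeff \<nu> n = (2 * real n + \<nu>) * (2 * real n + \<nu> - 1) / (fact n * 4 ^ n * pochhammer (\<nu> - 1) (n + 2))"

lemma F_coeff_Gamma:
  assumes "\<nu> > 1"
  shows "F_coeff \<nu> n = (2 * real n + \<nu>) * (2 * real n + \<nu> - 1) * Gamma (\<nu> - 1)
           / (fact n * Gamma (real n + \<nu> + 1) * 4 ^ n)"
proof -
  have ni: "\<nu> - 1 \<notin> \<int>\<^sub>\<le>\<^sub>0" using assms by (auto elim!: nonpos_Ints_cases)
  have G: "Gamma (\<nu> - 1) > 0" using assms by (intro Gamma_real_pos) auto
  have "Gamma (real n + \<nu> + 1) = Gamma (\<nu> - 1) * pochhammer (\<nu> - 1) (n + 2)"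
    using pochhammer_Gamma[OF ni, of "n + 2"] G by (simp add: field_simps)
  thus ?thesis using G by (simp add: F_coeff_def mult_ac del: pochhammer_Suc)
qed

lemma bessel_F_sums_F_coeff:
  assumes "\<nu> > 1"
  shows "(\<lambda>n. of_real ((-1) ^ n * F_coeff \<nu> n) * z ^ (n + 1)) sums bessel_F \<nu> z"
  using bessel_F_sums[OF assms, of z] by (simp add: F_coeff_Gamma[OF assms])

lemma F_coeff_pos: "\<nu> > 1 \<Longrightarrow> F_coeff \<nu> n > 0"
  unfolding F_coeff_def by (intro divide_pos_pos mult_pos_pos pochhammer_pos) auto

lemma F_coeff_0: "\<nu> > 1 \<Longrightarrow> F_coeff \<nu> 0 = 1"
  by (simp add: F_coeff_def pochhammer_rec numeral_2_eq_2)

lemma F_coeff_Suc: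
  assumes "\<nu> > 1"
  shows "F_coeff \<nu> (Suc n) = (2 * real n + \<nu> + 2) * (2 * real n + \<nu> + 1) /
           (4 * (real n + 1) * (real n + \<nu> + 1) * ((2 * real n + \<nu>) * (2 * real n + \<nu> - 1))) * F_coeff \<nu> n"
proof -
  have p: "pochhammer (\<nu> - 1) (n + 2) > 0" using assms by (intro pochhammer_pos) auto
  have q: "pochhammer (\<nu> - 1) (Suc n + 2) = pochhammer (\<nu> - 1) (n + 2) * (real n + \<nu> + 1)"
    using pochhammer_Suc[of "\<nu> - 1" "n + 2"] by (simp add: algebra_simps)
  have "2 * real n + \<nu> \<noteq> 0" "2 * real n + \<nu> - 1 \<noteq> 0" "real n + \<nu> + 1 \<noteq> 0" "real n + 1 \<noteq> 0" using assms by linarith+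
  thus ?thesis unfolding F_coeff_def q using p
    by (simp add: divide_simps) (simp add: algebra_simps)
qed

text \<open>
  Each of the three factors of the quotient of consecutive coefficients decreases in \<open>\<nu>\<close>; the bound is
  its value at \<open>\<nu> = 1\<close>. At \<open>n = 0\<close> the quotient has a pole there.
\<close>
lemma F_coeff_ratio:
  assumes "\<nu> > 1" "n \<ge> 1"
  shows "F_coeff \<nu> (Suc n) \<le> (2 * real n + 3) / (4 * real n * (real n + 2) * (2 * real n + 1)) * F_coeff \<nu> n"
proof -
  define m where "m = real n"
  have m: "m \<ge> 1" using assms by (simp add: m_def)
  have a: "(2 * m + \<nu> + 2) / (2 * m + \<nu>) \<le> (2 * m + 3) / (2 * m + 1)"
    using m assms by (simp add: field_simps)
  have b: "(2 * m + \<nu> + 1) / (2 * m + \<nu> - 1) \<le> (2 * m + 2) / (2 * m)"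
    using m assms by (simp add: field_simps)
  have c: "1 / (4 * (m + 1) * (m + \<nu> + 1)) \<le> 1 / (4 * (m + 1) * (m + 2))"
    using m assms by (intro divide_left_mono mult_left_mono mult_pos_pos) auto
  have "(2 * m + \<nu> + 2) / (2 * m + \<nu>) * ((2 * m + \<nu> + 1) / (2 * m + \<nu> - 1)) * (1 / (4 * (m + 1) * (m + \<nu> + 1)))
      \<le> (2 * m + 3) / (2 * m + 1) * ((2 * m + 2) / (2 * m)) * (1 / (4 * (m + 1) * (m + 2)))"
    using m assms by (intro mult_mono a b c mult_nonneg_nonneg divide_nonneg_nonneg) auto
  also have "\<dots> = (2 * m + 3) / (4 * m * (m + 2) * (2 * m + 1))"
  proof -
    have "m \<noteq> 0" "m + 2 \<noteq> 0" "2 * m + 1 \<noteq> 0" "m + 1 \<noteq> 0" using m by linarith+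
    thus ?thesis by (simp add: divide_simps) (simp add: algebra_simps)
  qed
  finally have "(2 * m + \<nu> + 2) * (2 * m + \<nu> + 1) / (4 * (m + 1) * (m + \<nu> + 1) * ((2 * m + \<nu>) * (2 * m + \<nu> - 1)))
     \<le> (2 * m + 3) / (4 * m * (m + 2) * (2 * m + 1))"
    by (simp add: mult_ac)
  from mult_right_mono[OF this less_imp_le[OF F_coeff_pos[OF assms(1), of n]]]
  show ?thesis unfolding F_coeff_Suc[OF assms(1)] m_def .
qed

lemma F_coeff_1:
  assumes "\<nu> > 1"
  shows "F_coeff \<nu> 1 = (\<nu> + 2) / (4 * \<nu> * (\<nu> - 1))"
proof -
  have "F_coeff \<nu> 1 = (\<nu> + 2) * (\<nu> + 1) / (4 * (\<nu> + 1) * (\<nu> * (\<nu> - 1)))"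
    using F_coeff_Suc[OF assms, of 0] by (simp add: F_coeff_0[OF assms])
  also have "4 * (\<nu> + 1) * (\<nu> * (\<nu> - 1)) = 4 * \<nu> * (\<nu> - 1) * (\<nu> + 1)" by (simp only: mult_ac)
  also have "\<nu> + 1 \<noteq> 0" using assms by simp
  hence "(\<nu> + 2) * (\<nu> + 1) / (4 * \<nu> * (\<nu> - 1) * (\<nu> + 1)) = (\<nu> + 2) / (4 * \<nu> * (\<nu> - 1))"
    by (rule nonzero_mult_divide_mult_cancel_right)
  finally show ?thesis .
qed

text \<open>
  The summands of the second moment of \<open>F'\<close>: they bound the increments of the real part of \<open>F'\<close>
  along a circle.
\<close>
definition moment :: "real \<Rightarrow> nat \<Rightarrow> real" where
  "moment \<nu> n = (real n)\<^sup>2 * (real n + 1) * F_coeff \<nu> n"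

lemma moment_ratio:
  assumes "\<nu> > 1" "n \<ge> 2"
  shows "moment \<nu> (Suc n) \<le> moment \<nu> n / 7"
proof -
  define m where "m = real n"
  have m: "m \<ge> 2" using assms by (simp add: m_def)
  have "moment \<nu> (Suc n) = (m + 1)\<^sup>2 * (m + 2) * F_coeff \<nu> (Suc n)" by (simp add: moment_def m_def algebra_simps)
  also have "\<dots> \<le> (m + 1)\<^sup>2 * (m + 2) * ((2 * m + 3) / (4 * m * (m + 2) * (2 * m + 1)) * F_coeff \<nu> n)"
    using F_coeff_ratio[OF assms(1), of n] assms m unfolding m_def by (intro mult_left_mono) auto
  also have "\<dots> = (m + 1)\<^sup>2 * (2 * m + 3) / (4 * m * (2 * m + 1)) * F_coeff \<nu> n"
  proof -
    have "m \<noteq> 0" "m + 2 \<noteq> 0" "2 * m + 1 \<noteq> 0" using m by linarith+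
    thus ?thesis by (simp add: divide_simps)
  qed
  also have "\<dots> \<le> m\<^sup>2 * (m + 1) / 7 * F_coeff \<nu> n"
  proof (intro mult_right_mono less_imp_le[OF F_coeff_pos] assms)
    have "7 * (m + 1) * (2 * m + 3) \<le> 4 * m ^ 3 * (2 * m + 1)"
    proof -
      define k where "k = m - 2"
      have k: "m = k + 2" "k \<ge> 0" using m by (auto simp: k_def)
      show ?thesis unfolding k(1) using k(2)
        by (simp add: algebra_simps power2_eq_square power3_eq_cube)
    qed
    hence "(m + 1) * (7 * (m + 1) * (2 * m + 3)) \<le> (m + 1) * (4 * m ^ 3 * (2 * m + 1))"
      using m by (intro mult_left_mono) auto
    also have "(m + 1) * (7 * (m + 1) * (2 * m + 3)) = 7 * ((m + 1)\<^sup>2 * (2 * m + 3))"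
      by (simp add: power2_eq_square)
    also have "(m + 1) * (4 * m ^ 3 * (2 * m + 1)) = m\<^sup>2 * (m + 1) * (4 * m * (2 * m + 1))"
      by (simp add: power2_eq_square power3_eq_cube)
    finally have "(m + 1)\<^sup>2 * (2 * m + 3) \<le> m\<^sup>2 * (m + 1) / 7 * (4 * m * (2 * m + 1))" by (simp only: times_divide_eq_left mult.commute[of 7] pos_le_divide_eq zero_less_numeral)
    moreover have "4 * m * (2 * m + 1) > 0" using m by (intro mult_pos_pos) auto
    ultimately show "(m + 1)\<^sup>2 * (2 * m + 3) / (4 * m * (2 * m + 1)) \<le> m\<^sup>2 * (m + 1) / 7"
      by (subst pos_divide_le_eq)
  qed
  finally show ?thesis by (simp add: moment_def m_def)
qed

lemma moment_nonneg: "\<nu> > 1 \<Longrightarrow> moment \<nu> n \<ge> 0"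
  using F_coeff_pos[of \<nu> n] by (simp add: moment_def)

lemma moment_geometric: "\<nu> > 1 \<Longrightarrow> moment \<nu> (n + 2) \<le> 12 * F_coeff \<nu> 2 * (1 / 7) ^ n"
proof (induction n)
  case 0 thus ?case by (simp add: moment_def numeral_2_eq_2)
next
  case (Suc n) thus ?case using moment_ratio[of \<nu> "n + 2"] by simp
qed

lemma summable_moment: "\<nu> > 1 \<Longrightarrow> summable (\<lambda>n. moment \<nu> (n + 2))"
  by (rule summable_comparison_test'[of "\<lambda>n. 12 * F_coeff \<nu> 2 * (1 / 7) ^ n"])
     (use moment_geometric[of \<nu>] moment_nonneg[of \<nu>] in \<open>auto intro!: summable_mult\<close>)

text \<open>
  The decisive numerical fact: \<open>35/18\<close> is less than the modulus \<open>2\<close> of the linear coefficient of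
  \<open>F'\<close> relative to \<open>F_coeff \<nu> 1\<close>.
\<close>
lemma suminf_moment_le:
  assumes "\<nu> > 1" shows "(\<Sum>n. moment \<nu> (n + 2)) \<le> 35 / 18 * F_coeff \<nu> 1"
proof -
  have "(\<Sum>n. moment \<nu> (n + 2)) \<le> (\<Sum>n. 12 * F_coeff \<nu> 2 * (1 / 7) ^ n)"
    by (intro suminf_le moment_geometric summable_moment assms summable_mult) auto
  also have "\<dots> = 14 * F_coeff \<nu> 2"
    by (subst suminf_mult) (auto simp: suminf_geometric)
  also have "\<dots> \<le> 35 / 18 * F_coeff \<nu> 1"
    using F_coeff_ratio[OF assms, of 1] by (simp add: numeral_2_eq_2)
  finally show ?thesis .
qed

text \<open>
  Every tail that occurs below, for \<open>F'\<close> as well as for \<open>F / z\<close>, is compared with the second moment of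
  \<open>F'\<close>; the factors \<open>C\<close> that arise are one and those of the next lemma.
\<close>
lemma moment_dominated:
  assumes "\<nu> > 1" "0 \<le> C" "\<And>n. n \<ge> 2 \<Longrightarrow> 0 \<le> w n \<and> w n \<le> C * moment \<nu> n"
  shows "summable (\<lambda>n. w (n + 2))" "(\<Sum>n. w (n + 2)) \<le> 35 / 18 * C * F_coeff \<nu> 1"
proof -
  have le: "w (n + 2) \<le> C * moment \<nu> (n + 2)" "0 \<le> w (n + 2)" for n
    using assms(3)[of "n + 2"] by auto
  have sm: "summable (\<lambda>n. C * moment \<nu> (n + 2))" by (rule summable_mult[OF summable_moment[OF assms(1)]])
  show *: "summable (\<lambda>n. w (n + 2))"
    by (rule summable_comparison_test'[OF sm]) (use le in auto)
  have "(\<Sum>n. w (n + 2)) \<le> (\<Sum>n. C * moment \<nu> (n + 2))"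
    by (intro suminf_le le sm *)
  also have "\<dots> \<le> C * (35 / 18 * F_coeff \<nu> 1)"
    unfolding suminf_mult[OF summable_moment[OF assms(1)]]
    by (rule mult_left_mono[OF suminf_moment_le[OF assms(1)] assms(2)])
  finally show "(\<Sum>n. w (n + 2)) \<le> 35 / 18 * C * F_coeff \<nu> 1" by simp
qed

lemma coeff_le_moment:
  assumes "\<nu> > 1" "n \<ge> 2"
  shows "real n * (real n + 1) * F_coeff \<nu> n \<le> 1 / 2 * moment \<nu> n"
    "(real n)\<^sup>2 * F_coeff \<nu> n \<le> 1 / 3 * moment \<nu> n"
    "real n * F_coeff \<nu> n \<le> 1 / 6 * moment \<nu> n"
proof -
  define x where "x = real n"
  have x: "x \<ge> 2" using assms by (simp add: x_def)
  define y where "y = x * x"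
  define w where "w = x * x * x"
  have e: "x\<^sup>2 * (x + 1) = w + y" "x * (x + 1) = y + x" "x\<^sup>2 = y"
    by (simp_all add: algebra_simps power2_eq_square y_def w_def)
  have h: "2 * x \<le> y" "2 * y \<le> w"
    using x mult_right_mono[of 2 x x] mult_right_mono[of 2 x "x * x"] by (simp_all add: mult.assoc y_def w_def)
  have "x * (x + 1) \<le> 1 / 2 * (x\<^sup>2 * (x + 1))" 
  proof -
    have "y + 2 * x \<le> y + y" using h(1) by simp
    also have "\<dots> \<le> w" using h(2) by simp
    finally show ?thesis unfolding e(1,2) by simp
  qed
  moreover have "x\<^sup>2 \<le> 1 / 3 * (x\<^sup>2 * (x + 1))" unfolding e(1) unfolding e(3) using h(2) by simp
  moreover have "x \<le> 1 / 6 * (x\<^sup>2 * (x + 1))" 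
  proof -
    have "6 * x \<le> 2 * y + y" using h(1) by simp
    also have "\<dots> \<le> w + y" using h(2) by simp
    finally show ?thesis unfolding e(1) by simp
  qed
  ultimately show "real n * (real n + 1) * F_coeff \<nu> n \<le> 1 / 2 * moment \<nu> n"
    "(real n)\<^sup>2 * F_coeff \<nu> n \<le> 1 / 3 * moment \<nu> n"
    "real n * F_coeff \<nu> n \<le> 1 / 6 * moment \<nu> n"
    using F_coeff_pos[OF assms(1), of n]
    unfolding x_def[symmetric] moment_def mult.assoc[symmetric, of _ _ "F_coeff \<nu> n"]
    by (simp_all only: mult_right_mono less_imp_le)
qed

section \<open>Derivatives close to a constant\<close>

text \<open>
  The power series coefficients of \<open>F'\<close>.
\<close>
definition deriv_coeff :: "real \<Rightarrow> nat \<Rightarrow> real" where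
  "deriv_coeff \<nu> n = (-1) ^ n * (real n + 1) * F_coeff \<nu> n"

lemma bessel_F_power_series:
  assumes "\<nu> > 1"
  shows "(\<lambda>k. (case k of 0 \<Rightarrow> 0 | Suc n \<Rightarrow> of_real ((-1) ^ n * F_coeff \<nu> n)) * z ^ k) sums bessel_F \<nu> z"
  using sums_Suc[of "\<lambda>k. (case k of 0 \<Rightarrow> 0 | Suc n \<Rightarrow> of_real ((-1) ^ n * F_coeff \<nu> n)) * z ^ k"]
    bessel_F_sums_F_coeff[OF assms, of z] by simp

lemma higher_deriv_bessel_F_sums:
  assumes "\<nu> > 1"
  shows "(\<lambda>n. of_real (fact (n + Suc m) / fact n * ((-1) ^ (n + m) * F_coeff \<nu> (n + m))) * z ^ n)
           sums (deriv ^^ Suc m) (bessel_F \<nu>) z"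
  using entire_series_higher_deriv(1)[OF bessel_F_power_series[OF assms], of "Suc m" z]
  by (simp add: mult_ac del: fact_Suc funpow.simps)

lemma has_field_derivative_bessel_F:
  assumes "\<nu> > 1"
  shows "((deriv ^^ m) (bessel_F \<nu>) has_field_derivative (deriv ^^ Suc m) (bessel_F \<nu>) z) (at z)"
  by (rule entire_series_higher_deriv(2)[OF bessel_F_power_series[OF assms]])

lemma deriv_bessel_F_sums:
  assumes "\<nu> > 1"
  shows "(\<lambda>n. of_real (deriv_coeff \<nu> n) * z ^ n) sums deriv (bessel_F \<nu>) z"
proof -
  have "fact (n + Suc 0) / fact n = real n + 1" for n by simp
  thus ?thesis using higher_deriv_bessel_F_sums[OF assms, of 0 z]
    by (simp add: deriv_coeff_def mult_ac del: fact_Suc)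
qed

lemma abs_deriv_coeff: "\<nu> > 1 \<Longrightarrow> \<bar>deriv_coeff \<nu> n\<bar> = (real n + 1) * F_coeff \<nu> n"
  using F_coeff_pos[of \<nu> n] by (simp add: deriv_coeff_def abs_mult)

text \<open>
  The coefficients of the derivative of order \<open>m + 1\<close> decrease by a factor of at most \<open>5/12\<close> from each
  to the next, and \<open>\<Sum>n\<ge>1. (5/12)^n = 5/7 < 1\<close>. For the first derivative this fails: its linear
  coefficient involves \<open>F_coeff \<nu> 1\<close>, which is unbounded as \<open>\<nu>\<close> approaches one.
\<close>
lemma higher_deriv_bessel_F_near_constant:
  assumes \<nu>: "\<nu> > 1" and m: "m \<ge> 1" and z: "z \<in> ball 0 1"
  shows "norm ((deriv ^^ Suc m) (bessel_F \<nu>) z - (deriv ^^ Suc m) (bessel_F \<nu>) 0)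
           < norm ((deriv ^^ Suc m) (bessel_F \<nu>) 0)"
proof -
  define a where "a n = fact (n + Suc m) / fact n * ((-1) ^ (n + m) * F_coeff \<nu> (n + m))" for n
  define h where "h = (deriv ^^ Suc m) (bessel_F \<nu>)"
  have h: "(\<lambda>n. of_real (a n) * z ^ n) sums h z" for z
    unfolding a_def h_def by (rule higher_deriv_bessel_F_sums[OF \<nu>])
  have h0: "h 0 = of_real (a 0)" using sums_unique2[OF h[of 0] powser_sums_zero[of "\<lambda>n. of_real (a n)"]] .
  have a0: "\<bar>a 0\<bar> > 0" using F_coeff_pos[OF \<nu>, of m] by (simp add: a_def)
  have step: "\<bar>a (Suc n)\<bar> \<le> 5 / 12 * \<bar>a n\<bar>" for n
  proof -
    define k where "k = n + m"
    define x where "x = real k"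
    have x: "x \<ge> 1" using m by (simp add: x_def k_def)
    define C where "C = fact (Suc k) / (fact n :: real)"
    have C: "C \<ge> 0" by (simp add: C_def)
    have an: "\<bar>a n\<bar> = C * F_coeff \<nu> k"
      using F_coeff_pos[OF \<nu>, of k] by (simp add: a_def C_def k_def abs_mult del: fact_Suc)
    have "\<bar>a (Suc n)\<bar> = fact (Suc (Suc k)) / fact (Suc n) * F_coeff \<nu> (Suc k)"
      using F_coeff_pos[OF \<nu>, of "Suc k"] by (simp add: a_def k_def abs_mult del: fact_Suc)
    also have "\<dots> = C * (x + 2) / (real n + 1) * F_coeff \<nu> (Suc k)"
      using fact_Suc[of "Suc k", where 'a = real] fact_Suc[of n, where 'a = real]
      by (simp add: C_def x_def algebra_simps del: fact_Suc)
    also have "\<dots> \<le> C * (x + 2) / 1 * F_coeff \<nu> (Suc k)"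
      using C x F_coeff_pos[OF \<nu>, of "Suc k"] by (intro mult_right_mono divide_left_mono) auto
    also have "\<dots> \<le> C * (x + 2) / 1 * ((2 * x + 3) / (4 * x * (x + 2) * (2 * x + 1)) * F_coeff \<nu> k)"
      using C x F_coeff_ratio[OF \<nu>, of k] by (intro mult_left_mono) (auto simp: x_def)
    also have "\<dots> = C * F_coeff \<nu> k * ((2 * x + 3) / (4 * x * (2 * x + 1)))"
    proof -
      have "x \<noteq> 0" "x + 2 \<noteq> 0" "2 * x + 1 \<noteq> 0" using x by linarith+
      thus ?thesis by (simp add: divide_simps)
    qed
    also have "(2 * x + 3) / (4 * x * (2 * x + 1)) \<le> 5 / 12"
    proof -
      have "(10 * x + 9) * (x - 1) \<ge> 0" using x by (intro mult_nonneg_nonneg) auto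
      moreover have "4 * x * (2 * x + 1) > 0" using x by (intro mult_pos_pos) auto
      ultimately show ?thesis using x by (subst pos_divide_le_eq) (auto simp: algebra_simps)
    qed
    hence "C * F_coeff \<nu> k * ((2 * x + 3) / (4 * x * (2 * x + 1))) \<le> C * F_coeff \<nu> k * (5 / 12)"
      using C F_coeff_pos[OF \<nu>, of k] by (intro mult_left_mono) auto
    finally show ?thesis by (simp add: an)
  qed
  have geo: "\<bar>a n\<bar> \<le> (5 / 12) ^ n * \<bar>a 0\<bar>" for n
  proof (induction n)
    case (Suc n) thus ?case using step[of n] by simp
  qed simp
  have tail: "(\<lambda>n. of_real (a (Suc n)) * z ^ Suc n) sums (h z - h 0)"
    using h[of z] by (subst sums_Suc_iff) (simp add: h0)
  have "norm (h z - h 0) \<le> 5 / 7 * \<bar>a 0\<bar>"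
  proof (rule norm_sums_le[OF tail])
    have "(\<lambda>n. 5 / 12 * \<bar>a 0\<bar> * (5 / 12) ^ n) sums (5 / 12 * \<bar>a 0\<bar> * (1 / (1 - 5 / 12)))"
      by (intro sums_mult geometric_sums) simp
    thus "(\<lambda>n. 5 / 12 * \<bar>a 0\<bar> * (5 / 12) ^ n) sums (5 / 7 * \<bar>a 0\<bar>)" by simp
    fix n
    have "\<bar>a (Suc n)\<bar> * norm z ^ Suc n \<le> \<bar>a (Suc n)\<bar> * 1"
      using z by (intro mult_left_mono power_le_one) auto
    also have "\<dots> \<le> 5 / 12 * \<bar>a 0\<bar> * (5 / 12) ^ n" using geo[of "Suc n"] by (simp add: mult_ac)
    finally show "norm (of_real (a (Suc n)) * z ^ Suc n) \<le> 5 / 12 * \<bar>a 0\<bar> * (5 / 12) ^ n"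
      by (simp only: norm_mult norm_power norm_of_real)
  qed
  thus ?thesis using a0 unfolding h_def[symmetric] h0 by simp
qed

lemma higher_deriv_bessel_F_close_to_convex:
  assumes "\<nu> > 1" "m \<ge> 1"
  shows "close_to_convex ((deriv ^^ m) (bessel_F \<nu>))" "inj_on ((deriv ^^ m) (bessel_F \<nu>)) (ball 0 1)"
  using near_linear_close_to_convex[OF has_field_derivative_bessel_F[OF assms(1)]
      higher_deriv_bessel_F_near_constant[OF assms]] by blast+

section \<open>Starlikeness and the sign of the derivative at one\<close>

lemma bessel_F_over_z:
  assumes "\<nu> > 1"
  obtains G where "\<And>z. (\<lambda>n. of_real ((-1) ^ n * F_coeff \<nu> n) * z ^ n) sums G z"
    "\<And>z. bessel_F \<nu> z = z * G z"
proof -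
  define g where "g = (\<lambda>n. complex_of_real ((-1) ^ n * F_coeff \<nu> n))"
  have F: "(\<lambda>n. z * (g n * z ^ n)) sums bessel_F \<nu> z" for z
    using bessel_F_sums_F_coeff[OF assms, of z] by (simp add: g_def mult_ac)
  have "\<exists>s. (\<lambda>n. g n * z ^ n) sums s" for z
  proof (cases "z = 0")
    case True thus ?thesis using powser_sums_zero[of g] by auto
  next
    case False
    from sums_mult[OF F[of z], of "inverse z"] have "(\<lambda>n. g n * z ^ n) sums (inverse z * bessel_F \<nu> z)"
      using False by (simp add: mult.assoc[symmetric])
    thus ?thesis by blast
  qed
  then obtain G where G: "\<And>z. (\<lambda>n. g n * z ^ n) sums G z" by metis
  moreover have "bessel_F \<nu> z = z * G z" for z
    using sums_unique2[OF F[of z] sums_mult[OF G[of z], of z]] .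
  ultimately show ?thesis using that unfolding g_def by blast
qed

lemma deriv_bessel_F_real:
  assumes "\<nu> > 1"
  shows "Im (deriv (bessel_F \<nu>) (of_real x)) = 0"
  using sums_Im[OF deriv_bessel_F_sums[OF assms, of "of_real x"]]
  by (simp flip: of_real_power of_real_mult add: sums_iff)

text \<open>
  The linear term of \<open>F'\<close> is \<open>-2 * F_coeff \<nu> 1 * x\<close>, and the rest has Lipschitz constant at most
  \<open>35/36 * F_coeff \<nu> 1\<close> on \<open>[0, 1]\<close>. This propagates \<open>F'(1) \<ge> 0\<close> to \<open>F'(r) > 0\<close> for \<open>r < 1\<close>.
\<close>
lemma deriv_bessel_F_antimono:
  assumes "\<nu> > 1" "0 \<le> r" "r < s" "s \<le> 1"
  shows "Re (deriv (bessel_F \<nu>) (of_real s)) < Re (deriv (bessel_F \<nu>) (of_real r))"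
proof -
  define P where "P = deriv (bessel_F \<nu>)"
  define b where "b = F_coeff \<nu> 1"
  have b: "b > 0" using F_coeff_pos assms by (simp add: b_def)
  have M: "summable (\<lambda>n. real (n + 2) * \<bar>deriv_coeff \<nu> (n + 2)\<bar>)"
      "(\<Sum>n. real (n + 2) * \<bar>deriv_coeff \<nu> (n + 2)\<bar>) \<le> 35 / 36 * b"
    using moment_dominated[OF assms(1), of "1 / 2" "\<lambda>n. real n * \<bar>deriv_coeff \<nu> n\<bar>"] coeff_le_moment(1)[OF assms(1)] F_coeff_pos[OF assms(1)]
    by (auto simp: abs_deriv_coeff[OF assms(1)] b_def mult.assoc less_imp_le)
  from series_increment[OF deriv_bessel_F_sums[OF assms(1)] M(1), of "of_real r" "of_real s"]
  have "norm (P (of_real r) - P (of_real s) - of_real (deriv_coeff \<nu> 1) * (of_real r - of_real s)) 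
     \<le> norm (complex_of_real r - of_real s) * (\<Sum>n. real (n + 2) * \<bar>deriv_coeff \<nu> (n + 2)\<bar>)"
    using assms by (simp add: P_def)
  also have "\<dots> \<le> (s - r) * (35 / 36 * b)"
  proof -
    have "norm (complex_of_real r - of_real s) = s - r"
      using assms by (simp flip: of_real_diff)
    thus ?thesis using assms M(2) by (simp only: mult_left_mono)
  qed
  finally have "\<bar>Re (P (of_real r) - P (of_real s) - of_real (deriv_coeff \<nu> 1) * (of_real r - of_real s))\<bar>
      \<le> (s - r) * (35 / 36 * b)" using abs_Re_le_cmod order_trans by blast
  moreover have "deriv_coeff \<nu> 1 = - 2 * b" by (simp add: deriv_coeff_def b_def)
  ultimately have "\<bar>Re (P (of_real r)) - Re (P (of_real s)) - 2 * ((s - r) * b)\<bar> \<le> (s - r) * b * (35 / 36)"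
    by (simp add: algebra_simps)
  moreover have "(s - r) * b > 0" using assms b by simp
  ultimately show ?thesis unfolding P_def by linarith
qed


text \<open>
  The values at \<open>z\<close> are compared with those at \<open>r = \<bar>z\<bar>\<close>. With \<open>p = F'(r)\<close>, \<open>g = G r\<close> and
  increments \<open>A\<close> and \<open>B\<close> of \<open>F'\<close> and \<open>G = F / z\<close>, the product \<open>(p + A) * cnj (g + B)\<close> has real part
  \<open>p * g + p * Re B + g * Re A + Re (A * cnj B)\<close>, in which no term is negative.
\<close>
lemma bessel_F_Re_estimates:
  assumes \<nu>: "\<nu> > 1" and pos: "Re (deriv (bessel_F \<nu>) 1) \<ge> 0" and z: "z \<in> ball 0 1"
  shows "Re (deriv (bessel_F \<nu>) z) > 0"
    "z \<noteq> 0 \<Longrightarrow> Re (z * deriv (bessel_F \<nu>) z * cnj (bessel_F \<nu> z)) > 0"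
proof -
  define r where "r = norm z"
  have r: "0 \<le> r" "r < 1" "norm z = r" using z by (auto simp: r_def)
  define P where "P = deriv (bessel_F \<nu>)"
  define b where "b = F_coeff \<nu> 1"
  have b: "b > 0" using F_coeff_pos \<nu> by (simp add: b_def)
  obtain G where G: "\<And>z. (\<lambda>n. of_real ((-1) ^ n * F_coeff \<nu> n) * z ^ n) sums G z"
    and F: "\<And>z. bessel_F \<nu> z = z * G z" using bessel_F_over_z[OF \<nu>] by blast
  define v where "v n = (-1) ^ n * F_coeff \<nu> n" for n
  have G: "(\<lambda>n. of_real (v n) * z ^ n) sums G z" for z using G by (simp add: v_def)
  have P: "(\<lambda>n. of_real (deriv_coeff \<nu> n) * z ^ n) sums P z" for z
    unfolding P_def by (rule deriv_bessel_F_sums[OF \<nu>])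
  have av: "\<bar>v n\<bar> = F_coeff \<nu> n" for n using F_coeff_pos[OF \<nu>, of n] by (simp add: v_def abs_mult)
  have v1: "v 1 = - b" and d1: "deriv_coeff \<nu> 1 = - 2 * b" by (simp_all add: v_def b_def deriv_coeff_def)
  have \<delta>: "r - Re z \<ge> 0" using complex_Re_le_cmod[of z] by (simp add: r_def)
  define p where "p = Re (P (of_real r))"
  define g where "g = Re (G (of_real r))"
  have "Im (G (of_real r)) = 0"
    using sums_Im[OF G[of "of_real r"]] by (simp flip: of_real_power of_real_mult add: sums_iff)
  hence Gr: "G (of_real r) = of_real g" by (simp add: g_def complex_eq_iff)
  have Pr: "P (of_real r) = of_real p"
    using deriv_bessel_F_real[OF \<nu>, of r] by (simp add: p_def P_def complex_eq_iff)
  have p: "p > 0"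
    using deriv_bessel_F_antimono[OF \<nu> r(1,2)] pos by (simp add: p_def P_def)
  have sP1: "summable (\<lambda>n. real (n + 2) * \<bar>deriv_coeff \<nu> (n + 2)\<bar>)"
      "(\<Sum>n. real (n + 2) * \<bar>deriv_coeff \<nu> (n + 2)\<bar>) \<le> 35 / 36 * b"
    using moment_dominated[OF \<nu>, of "1 / 2" "\<lambda>n. real n * \<bar>deriv_coeff \<nu> n\<bar>"] coeff_le_moment(1)[OF \<nu>] F_coeff_pos[OF \<nu>]
    by (auto simp: abs_deriv_coeff[OF \<nu>] b_def mult.assoc less_imp_le)
  have sP2: "summable (\<lambda>n. (real (n + 2))\<^sup>2 * \<bar>deriv_coeff \<nu> (n + 2)\<bar>)"
      "(\<Sum>n. (real (n + 2))\<^sup>2 * \<bar>deriv_coeff \<nu> (n + 2)\<bar>) \<le> 35 / 18 * b"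
    using moment_dominated[OF \<nu>, of "1" "\<lambda>n. (real n)\<^sup>2 * \<bar>deriv_coeff \<nu> n\<bar>"]  F_coeff_pos[OF \<nu>]
    by (auto simp: abs_deriv_coeff[OF \<nu>] moment_def b_def mult.assoc less_imp_le)
  have sG1: "summable (\<lambda>n. real (n + 2) * \<bar>v (n + 2)\<bar>)"
      "(\<Sum>n. real (n + 2) * \<bar>v (n + 2)\<bar>) \<le> 35 / 108 * b"
    using moment_dominated[OF \<nu>, of "1 / 6" "\<lambda>n. real n * \<bar>v n\<bar>"] coeff_le_moment(3)[OF \<nu>] F_coeff_pos[OF \<nu>]
    by (auto simp: av b_def mult.assoc less_imp_le)
  have sG2: "summable (\<lambda>n. (real (n + 2))\<^sup>2 * \<bar>v (n + 2)\<bar>)"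
      "(\<Sum>n. (real (n + 2))\<^sup>2 * \<bar>v (n + 2)\<bar>) \<le> 35 / 54 * b"
    using moment_dominated[OF \<nu>, of "1 / 3" "\<lambda>n. (real n)\<^sup>2 * \<bar>v n\<bar>"] coeff_le_moment(2)[OF \<nu>] F_coeff_pos[OF \<nu>]
    by (auto simp: av b_def mult.assoc less_imp_le)
  have RP: "Re (P z - of_real p) \<ge> 0"
  proof -
    have "\<bar>Re (P z - of_real p) + (- 2 * b) * (r - Re z)\<bar> \<le> (r - Re z) * (35 / 18 * b)"
      using series_Re_increment[OF P sP2(1) r(3)] r mult_left_mono[OF sP2(2) \<delta>] unfolding Pr d1 by linarith
    moreover have "(- 2 * b) * (r - Re z) = - 2 * ((r - Re z) * b)" "(r - Re z) * (35 / 18 * b) = 35 / 18 * ((r - Re z) * b)"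
      by simp_all
    moreover have "(r - Re z) * b \<ge> 0" using b \<delta> by simp
    ultimately show ?thesis by linarith
  qed
  have RG: "Re (G z - of_real g) \<ge> 0"
  proof -
    have "\<bar>Re (G z - of_real g) + (- b) * (r - Re z)\<bar> \<le> (r - Re z) * (35 / 54 * b)"
      using series_Re_increment[OF G sG2(1) r(3)] r mult_left_mono[OF sG2(2) \<delta>] unfolding Gr v1 by linarith
    moreover have "(- b) * (r - Re z) = - ((r - Re z) * b)" "(r - Re z) * (35 / 54 * b) = 35 / 54 * ((r - Re z) * b)"
      by simp_all
    moreover have "(r - Re z) * b \<ge> 0" using b \<delta> by simp
    ultimately show ?thesis by linarith
  qed
  show "Re (deriv (bessel_F \<nu>) z) > 0" using RP p by (simp add: P_def)
  \<comment> \<open>\<open>G - F'\<close> has the terms \<open>(-1)^(n+1) * n * F_coeff \<nu> n * z^n\<close>, the linear one of which dominates, so that \<open>G r \<ge> F'(r)\<close>.\<close>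
  have g: "g > 0"
  proof -
    define q where "q n = v n - deriv_coeff \<nu> n" for n
    have q: "(\<lambda>n. of_real (q n) * x ^ n) sums (G x - P x)" for x
      using sums_diff[OF G[of x] P[of x]] by (simp add: q_def algebra_simps)
    have "\<bar>q n\<bar> = real n * F_coeff \<nu> n" for n
      using F_coeff_pos[OF \<nu>, of n] by (simp add: q_def v_def deriv_coeff_def abs_mult algebra_simps)
    hence sq: "summable (\<lambda>n. real (n + 2) * \<bar>q (n + 2)\<bar>)"
      "(\<Sum>n. real (n + 2) * \<bar>q (n + 2)\<bar>) \<le> 35 / 54 * b"
      using sG2 by (simp_all add: av power2_eq_square mult.assoc)
    have zero: "G 0 - P 0 = 0"
      using sums_unique2[OF q[of 0] powser_sums_zero[of "\<lambda>n. of_real (q n)"]] by (simp add: q_def v_def deriv_coeff_def)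
    have "norm ((G (of_real r) - P (of_real r)) - (G 0 - P 0) - of_real (q 1) * (of_real r - 0))
        \<le> norm (complex_of_real r - 0) * (\<Sum>n. real (n + 2) * \<bar>q (n + 2)\<bar>)"
      using r by (intro series_increment[OF q sq(1)]) auto
    also have "\<dots> \<le> r * (35 / 54 * b)" using r mult_left_mono[OF sq(2) r(1)] by simp
    also have "(G (of_real r) - P (of_real r)) - (G 0 - P 0) - of_real (q 1) * (of_real r - 0)
        = complex_of_real (g - p - b * r)"
      unfolding zero Gr Pr by (simp add: q_def v1[simplified] d1[simplified])
    finally have "\<bar>g - p - b * r\<bar> \<le> r * (35 / 54 * b)" by (simp only: norm_of_real)
    moreover have "r * (35 / 54 * b) = 35 / 54 * (b * r)" by simp
    moreover have "b * r \<ge> 0" using r b by simp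
    ultimately show ?thesis using p by linarith
  qed
  have nr: "norm (complex_of_real r) \<le> 1" "norm z \<le> 1" using r by auto
  define d where "d = z - of_real r"
  define e1 where "e1 = P z - of_real p + of_real (2 * b) * d"
  define e2 where "e2 = G z - of_real g + of_real b * d"
  have "norm e1 \<le> b * norm d"
  proof -
    have "norm e1 \<le> norm d * (35 / 36 * b)"
      using series_increment[OF P sP1(1) nr(2,1)] mult_left_mono[OF sP1(2) norm_ge_zero[of d]]
      unfolding Pr d1 d_def e1_def by simp
    also have "\<dots> \<le> norm d * b" using b by (intro mult_left_mono) auto
    finally show ?thesis by (simp add: mult.commute)
  qed
  moreover have "norm e2 \<le> b / 3 * norm d"
  proof -
    have "norm e2 \<le> norm d * (35 / 108 * b)"
      using series_increment[OF G sG1(1) nr(2,1)] mult_left_mono[OF sG1(2) norm_ge_zero[of d]]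
      unfolding Gr v1 d_def e2_def by simp
    also have "\<dots> \<le> norm d * (b / 3)" using b by (intro mult_left_mono) auto
    finally show ?thesis by (simp add: mult.commute)
  qed
  ultimately have "Re ((P z - of_real p) * cnj (G z - of_real g)) \<ge> 0"
    using Re_mult_cnj_near_parallel_nonneg[of b e1 d e2] b by (simp add: e1_def e2_def)
  hence "Re (P z * cnj (G z)) > 0"
    using Re_mult_cnj_expand[of p "P z - of_real p" g "G z - of_real g"] mult_pos_pos[OF p g]
      mult_nonneg_nonneg[OF less_imp_le[OF p] RG] mult_nonneg_nonneg[OF less_imp_le[OF g] RP] by simp
  moreover assume "z \<noteq> 0"
  moreover have "z * P z * cnj (z * G z) = of_real ((norm z)\<^sup>2) * (P z * cnj (G z))"
    by (simp only: complex_norm_square) (simp add: mult_ac)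
  moreover have "Re (of_real x * X) = x * Re X" for x X by simp
  ultimately show "Re (z * deriv (bessel_F \<nu>) z * cnj (bessel_F \<nu> z)) > 0"
    unfolding F P_def[symmetric] by (metis mult_pos_pos zero_less_norm_iff zero_less_power)
qed

text \<open>
  Univalence already forces \<open>F'(1) \<ge> 0\<close>, because \<open>F'\<close> is real and continuous on \<open>[0, 1]\<close> with
  \<open>F'(0) = 1\<close> and may not vanish on \<open>[0, 1)\<close>.
\<close>
lemma starlike_bessel_F_iff:
  assumes "\<nu> > 1"
  shows "starlike_fun (bessel_F \<nu>) \<longleftrightarrow> Re (deriv (bessel_F \<nu>) 1) \<ge> 0"
proof
  define P where "P = deriv (bessel_F \<nu>)"
  have F': "(bessel_F \<nu> has_field_derivative P z) (at z)" for z
    using has_field_derivative_bessel_F[OF assms, of 0] by (simp add: P_def)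
  have hol: "bessel_F \<nu> holomorphic_on ball 0 1"
    unfolding holomorphic_on_open[OF open_ball] using F' by blast
  {
    assume pos: "Re (deriv (bessel_F \<nu>) 1) \<ge> 0"
    show "starlike_fun (bessel_F \<nu>)"
    proof (rule starlike_funI[OF hol])
      show "bessel_F \<nu> 0 = 0" by (simp add: bessel_F_def)
      show "inj_on (bessel_F \<nu>) (ball 0 1)"
        using bessel_F_Re_estimates(1)[OF assms pos] F'
        by (intro inj_on_of_Re_deriv_pos[of _ _ P]) (auto simp: P_def)
    qed (rule bessel_F_Re_estimates(2)[OF assms pos])
  next
    assume st: "starlike_fun (bessel_F \<nu>)"
    show "Re (deriv (bessel_F \<nu>) 1) \<ge> 0"
    proof (rule ccontr)
      assume neg: "\<not> Re (deriv (bessel_F \<nu>) 1) \<ge> 0"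
      have "(P has_field_derivative (deriv ^^ 2) (bessel_F \<nu>) z) (at z)" for z
        using has_field_derivative_bessel_F[OF assms, of 1] by (simp add: P_def numeral_2_eq_2)
      hence "isCont P z" for z by (rule DERIV_isCont)
      hence cont: "continuous_on {0..1} (\<lambda>x. Re (P (of_real x)))"
        by (intro continuous_on_Re continuous_on_compose2[OF continuous_at_imp_continuous_on[of UNIV P]]
             continuous_on_of_real_id) auto
      have "P 0 = 1"
        using sums_unique2[OF deriv_bessel_F_sums[OF assms, of 0] powser_sums_zero[of "\<lambda>n. of_real (deriv_coeff \<nu> n)"]]
        by (simp add: P_def deriv_coeff_def F_coeff_0[OF assms])
      hence "\<exists>x\<ge>0. x \<le> 1 \<and> Re (P (of_real x)) = 0"
        using neg by (intro IVT2' cont) (auto simp: P_def)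
      then obtain x where x: "0 \<le> x" "x \<le> 1" "Re (P (of_real x)) = 0" by blast
      have "x \<noteq> 1" using x neg by (auto simp: P_def)
      moreover have "P (of_real x) = 0"
        using x deriv_bessel_F_real[OF assms, of x] by (simp add: P_def complex_eq_iff)
      ultimately show False
        using holomorphic_injective_imp_regular[OF hol open_ball, of "of_real x"] st x
        by (simp add: starlike_fun_def P_def)
    qed
  }
qed

section \<open>The derivative at one in terms of Bessel functions\<close>

text \<open>
  The series of \<open>J\<^sub>\<nu>(1)\<close> without its factor \<open>(1/2) powr \<nu>\<close>, with real terms.
\<close>
definition bessel_term :: "real \<Rightarrow> nat \<Rightarrow> real" where
  "bessel_term \<nu> n = (-1) ^ n / (fact n * Gamma (real n + \<nu> + 1) * 4 ^ n)"

lemma Gamma_pos_shift: "\<nu> > 1 \<Longrightarrow> Gamma (real n + \<nu> + 1) > 0"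
  by (intro Gamma_real_pos) auto

lemma bessel_term_Suc:
  assumes "\<nu> > 1"
  shows "4 * (real n + 1) * (real n + \<nu> + 1) * bessel_term \<nu> (Suc n) = - bessel_term \<nu> n"
proof -
  have "real n + \<nu> + 1 \<notin> \<int>\<^sub>\<le>\<^sub>0" using assms by (auto elim!: nonpos_Ints_cases)
  from Gamma_plus1[OF this]
  have "Gamma (real (Suc n) + \<nu> + 1) = (real n + \<nu> + 1) * Gamma (real n + \<nu> + 1)"
    by (simp add: add_ac)
  moreover have "real n + \<nu> + 1 > 0" "real n + 1 > 0" using assms by auto
  ultimately show ?thesis using Gamma_pos_shift[OF assms, of n]
    by (simp add: bessel_term_def divide_simps)
qed

text \<open>
  This is how the first moment of the series of \<open>J\<^sub>\<nu>(1)\<close> turns into \<open>J\<^sub>\<nu>\<^sub>+\<^sub>1(1)\<close>.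
\<close>
lemma Suc_mult_bessel_term_Suc:
  "(real n + 1) * bessel_term \<nu> (Suc n) = - bessel_term (\<nu> + 1) n / 4"
proof -
  have "real (Suc n) + \<nu> + 1 = real n + (\<nu> + 1) + 1" by simp
  moreover have "(real n + 1) / fact (Suc n) = 1 / fact n"
    by (simp add: divide_simps)
  ultimately show ?thesis unfolding bessel_term_def
    by (simp only: power_Suc) (simp add: divide_simps)
qed

lemma bessel_J_1:
  assumes "\<nu> > 1"
  shows "summable (bessel_term \<nu>)" "bessel_J \<nu> 1 = of_real ((1 / 2) powr \<nu> * (\<Sum>n. bessel_term \<nu> n))"
proof -
  have c: "bessel_coeff \<nu> n = of_real (bessel_term \<nu> n)" for n
    by (simp add: bessel_coeff_def bessel_term_def)
  have "summable (\<lambda>n. complex_of_real (bessel_term \<nu> n))"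
    using bessel_coeff_summable[OF assms, of 1] by (simp add: c)
  thus s: "summable (bessel_term \<nu>)" by (simp only: summable_of_real_iff)
  have "(1 / 2 :: complex) powr of_real \<nu> = of_real ((1 / 2) powr \<nu>)"
    using powr_of_real[of "1 / 2" \<nu>] by simp
  thus "bessel_J \<nu> 1 = of_real ((1 / 2) powr \<nu> * (\<Sum>n. bessel_term \<nu> n))"
    using bessel_J_sums[OF assms, of 1] by (simp add: c suminf_of_real[OF s])
qed

lemma deriv_bessel_F_1_sums:
  assumes "\<nu> > 1"
  shows "deriv_coeff \<nu> sums Re (deriv (bessel_F \<nu>) 1)"
  using sums_Re[OF deriv_bessel_F_sums[OF assms, of 1]] by simp

text \<open>
  With \<open>t n = bessel_term \<nu> n\<close>, the recurrence \<open>4 n (n + \<nu>) t n = - t (n - 1)\<close> lowers the degree of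
  the cubic polynomial in \<open>(n + 1) (2n + \<nu>) (2n + \<nu> - 1) t n\<close> to one, up to a telescoping term.
  What is left is a combination of the moments of order zero and one of \<open>t\<close>, hence of \<open>J\<^sub>\<nu>(1)\<close>
  and \<open>J\<^sub>\<nu>\<^sub>+\<^sub>1(1)\<close>.
\<close>
lemma deriv_bessel_F_1_eq_bessel_J:
  assumes "\<nu> > 1"
  shows "of_real (2 * (1 / 2) powr \<nu> * Re (deriv (bessel_F \<nu>) 1)) =
    of_real (Gamma (\<nu> - 1)) * (of_real (2 * \<nu>\<^sup>2 - 2 * \<nu> - 3) * bessel_J \<nu> 1
       - of_real (\<nu>\<^sup>2 + \<nu> - 3) * bessel_J (\<nu> + 1) 1)"
proof -
  define t where "t = bessel_term \<nu>"
  define T where "T = (\<lambda>\<nu>. \<Sum>n. bessel_term \<nu> n)"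
  define D where "D = Re (deriv (bessel_F \<nu>) 1)"
  \<comment> \<open>The telescoping sequence; by the recurrence, \<open>y (n + 1) = (n + 3/2) * t n\<close>.\<close>
  define y where "y n = - (4 * real n + 2) * real n * (real n + \<nu>) * t n" for n
  have T0: "t sums T \<nu>" unfolding t_def T_def using bessel_J_1(1)[OF assms] by (rule summable_sums)
  have T1: "bessel_term (\<nu> + 1) sums T (\<nu> + 1)" unfolding T_def using bessel_J_1(1)[of "\<nu> + 1"] assms by (intro summable_sums) auto
  have nt: "(\<lambda>n. real n * t n) sums (- T (\<nu> + 1) / 4)"
  proof -
    have "(\<lambda>n. real (Suc n) * t (Suc n)) sums (- T (\<nu> + 1) / 4)"
      using sums_mult[OF T1, of "- 1 / 4"] Suc_mult_bessel_term_Suc[of _ \<nu>] by (simp add: t_def add.commute)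
    thus ?thesis by (subst (asm) sums_Suc_iff) simp
  qed
  have ySuc: "y (Suc n) = real n * t n + 3 / 2 * t n" for n
  proof -
    have "y (Suc n) = - (real n + 3 / 2) * (4 * (real n + 1) * (real n + \<nu> + 1) * t (Suc n))"
      by (simp add: y_def algebra_simps)
    also have "\<dots> = (real n + 3 / 2) * t n" unfolding t_def bessel_term_Suc[OF assms] by (simp add: algebra_simps)
    finally show ?thesis by (simp add: algebra_simps)
  qed
  have "y \<longlonglongrightarrow> 0"
  proof -
    have "(\<lambda>n. real n * t n + 3 / 2 * t n) \<longlonglongrightarrow> 0"
      using tendsto_add[OF summable_LIMSEQ_zero[OF sums_summable[OF nt]]
          tendsto_mult_right_zero[OF summable_LIMSEQ_zero[OF sums_summable[OF T0]], of "3 / 2"]] by simp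
    hence "(\<lambda>n. y (Suc n)) \<longlonglongrightarrow> 0" unfolding ySuc .
    thus ?thesis by (simp only: filterlim_sequentially_Suc)
  qed
  from telescope_sums[OF this] have tel: "(\<lambda>n. y (Suc n) - y n) sums 0" by (simp add: y_def)
  define A where "A = \<nu>\<^sup>2 - \<nu> - 3 / 2"
  define B where "B = \<nu>\<^sup>2 + \<nu> - 3"
  have "(\<lambda>n. Gamma (\<nu> - 1) * (A * t n + B * (real n * t n) + (y (Suc n) - y n)))
     sums (Gamma (\<nu> - 1) * (A * T \<nu> + B * (- T (\<nu> + 1) / 4) + 0))"
    by (intro sums_mult sums_add T0 nt tel)
  moreover have "Gamma (\<nu> - 1) * (A * t n + B * (real n * t n) + (y (Suc n) - y n)) = deriv_coeff \<nu> n" for n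
  proof -
    have "A * t n + B * (real n * t n) + (y (Suc n) - y n)
        = (real n + 1) * ((2 * real n + \<nu>) * (2 * real n + \<nu> - 1)) * t n"
      unfolding ySuc by (simp add: A_def B_def y_def algebra_simps power2_eq_square)
    thus ?thesis by (simp add: deriv_coeff_def F_coeff_Gamma[OF assms] t_def bessel_term_def mult_ac)
  qed
  ultimately have D: "D = Gamma (\<nu> - 1) * (A * T \<nu> - B * T (\<nu> + 1) / 4)"
    using sums_unique2[OF deriv_bessel_F_1_sums[OF assms]] by (simp add: D_def)
  have J: "bessel_J \<nu> 1 = of_real ((1 / 2) powr \<nu> * T \<nu>)"
      "bessel_J (\<nu> + 1) 1 = of_real ((1 / 2) powr \<nu> * (T (\<nu> + 1) / 2))"
    using bessel_J_1(2)[OF assms] bessel_J_1(2)[of "\<nu> + 1"] assms by (simp_all add: T_def powr_add)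
  have "2 * (1 / 2) powr \<nu> * D = Gamma (\<nu> - 1) * ((2 * A) * ((1 / 2) powr \<nu> * T \<nu>)
       - B * ((1 / 2) powr \<nu> * (T (\<nu> + 1) / 2)))"
    unfolding D by (simp add: algebra_simps)
  also have "2 * A = 2 * \<nu>\<^sup>2 - 2 * \<nu> - 3" by (simp add: A_def)
  finally show ?thesis unfolding J D_def[symmetric] B_def by (simp only: of_real_mult of_real_diff)
qed

lemma bessel_J_equation_iff:
  assumes "\<nu> > 1"
  shows "of_real (2 * \<nu>\<^sup>2 - 2 * \<nu> - 3) * bessel_J \<nu> 1 = of_real (\<nu>\<^sup>2 + \<nu> - 3) * bessel_J (\<nu> + 1) 1
    \<longleftrightarrow> Re (deriv (bessel_F \<nu>) 1) = 0"
proof -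
  have "Gamma (\<nu> - 1) > 0" using assms by (intro Gamma_real_pos) auto
  moreover have "(1 / 2) powr \<nu> \<noteq> (0 :: real)" by simp
  ultimately show ?thesis
    using deriv_bessel_F_1_eq_bessel_J[OF assms] 
    by (metis eq_iff_diff_eq_0 less_irrefl mult_eq_0_iff of_real_eq_0_iff zero_neq_numeral)
qed

section \<open>Monotonicity in the order\<close>

text \<open>
  Every factor satisfies \<open>x + k \<ge> (1 - (y - x) / 2) * (y + k)\<close> since \<open>y + k \<ge> 2\<close>; the product of
  these bounds is estimated as in Bernoulli's inequality.
\<close>
lemma pochhammer_shift_le:
  fixes x y :: real
  assumes "2 \<le> x" "x \<le> y"
  shows "(1 - real n * (y - x) / 2) * pochhammer y n \<le> pochhammer x n"
proof (induction n)
  case (Suc n)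
  define h where "h = y - x"
  have h: "h \<ge> 0" "y = x + h" using assms by (auto simp: h_def)
  have P: "pochhammer y n > 0" using assms by (intro pochhammer_pos) auto
  have "0 \<le> h / 2 * (x + real n - 2) + h * h / 2 + real n * h * h / 2"
    using assms h by (intro add_nonneg_nonneg mult_nonneg_nonneg divide_nonneg_nonneg) auto
  also have "\<dots> = (1 - real n * h / 2) * (x + real n) - (1 - real (Suc n) * h / 2) * (y + real n)"
    unfolding h(2) by (simp add: field_simps)
  finally have "(1 - real (Suc n) * h / 2) * (y + real n) \<le> (1 - real n * h / 2) * (x + real n)" by simp
  from mult_left_mono[OF this less_imp_le[OF P]]
  have "(1 - real (Suc n) * h / 2) * pochhammer y (Suc n) \<le> ((1 - real n * h / 2) * pochhammer y n) * (x + real n)"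
    by (simp add: pochhammer_Suc mult_ac)
  also have "\<dots> \<le> pochhammer x n * (x + real n)"
    using Suc.IH assms unfolding h_def by (intro mult_right_mono) auto
  finally show ?case by (simp add: pochhammer_Suc h_def)
qed simp

lemma pochhammer_mono:
  fixes x y :: real
  assumes "0 < x" "x \<le> y"
  shows "pochhammer x n \<le> pochhammer y n"
  unfolding pochhammer_prod using assms by (intro prod_mono) auto

text \<open>
  The factor \<open>\<nu> * (\<nu> - 1)\<close> removes the pole of \<open>F_coeff \<nu> 1\<close> at \<open>\<nu> = 1\<close> and makes the first two terms of
  the series polynomials in \<open>\<nu>\<close>.
\<close>
definition scaled_deriv_at_1 :: "real \<Rightarrow> real" where
  "scaled_deriv_at_1 \<nu> = \<nu> * (\<nu> - 1) * Re (deriv (bessel_F \<nu>) 1)"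

definition scaled_coeff :: "real \<Rightarrow> nat \<Rightarrow> real" where
  "scaled_coeff \<nu> n = \<nu> * (\<nu> - 1) * (real n + 1) * F_coeff \<nu> n"

lemma scaled_coeff_eq:
  assumes "\<nu> > 1"
  shows "scaled_coeff \<nu> n = (real n + 1) / (fact n * 4 ^ n) * ((2 * real n + \<nu>) * (2 * real n + \<nu> - 1) / pochhammer (\<nu> + 1) n)"
proof -
  have "pochhammer (\<nu> - 1) (n + 2) = \<nu> * (\<nu> - 1) * pochhammer (\<nu> + 1) n"
    using pochhammer_rec[of "\<nu> - 1" "Suc n"] pochhammer_rec[of \<nu> n] by (simp del: pochhammer_Suc)
  thus ?thesis using assms by (simp add: scaled_coeff_def F_coeff_def)
qed

text \<open>
  From \<open>n = 2\<close> on, \<open>scaled_coeff \<nu> n\<close> decreases in \<open>\<nu>\<close>, and its logarithmic derivative is at least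
  \<open>-n/2\<close> because the Pochhammer symbol in its denominator has \<open>n\<close> factors, all of them at least two.
\<close>
lemma scaled_coeff_diff:
  assumes "1 < \<nu>" "\<nu> \<le> \<mu>" "n \<ge> 2"
  shows "\<bar>scaled_coeff \<mu> n - scaled_coeff \<nu> n\<bar> \<le> (\<mu> - \<nu>) * (real n / 2 * scaled_coeff \<nu> n)"
proof -
  define x where "x = real n"
  have x: "x \<ge> 2" using assms by (simp add: x_def)
  define K where "K = (x + 1) / (fact n * 4 ^ n)"
  have K: "K > 0" using x by (simp add: K_def)
  have c: "scaled_coeff \<alpha> n = K * ((2 * x + \<alpha>) * (2 * x + \<alpha> - 1) / pochhammer (\<alpha> + 1) n)" if "\<alpha> > 1" for \<alpha>
    using scaled_coeff_eq[OF that, of n] by (simp add: K_def x_def)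
  have pn: "pochhammer (\<nu> + 1) n > 0" and pm: "pochhammer (\<mu> + 1) n > 0"
    using assms by (auto intro!: pochhammer_pos)
  \<comment> \<open>Splitting off the first two factors of the Pochhammer symbol exhibits monotonicity: \<open>(2n + \<alpha>) / (\<alpha> + 2)\<close> and \<open>(2n + \<alpha> - 1) / (\<alpha> + 1)\<close> decrease in \<open>\<alpha>\<close> for \<open>n \<ge> 1\<close>.\<close>
  obtain k where k: "n = Suc (Suc k)" using assms(3) by (metis Suc_le_D numeral_2_eq_2 Suc_le_mono)
  have c': "scaled_coeff \<alpha> n = K * ((1 + (2 * x - 2) / (\<alpha> + 2)) * (1 + (2 * x - 2) / (\<alpha> + 1)) / pochhammer (\<alpha> + 3) k)"
    if "\<alpha> > 1" for \<alpha>
  proof -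
    have "pochhammer (\<alpha> + 1) n = (\<alpha> + 1) * ((\<alpha> + 2) * pochhammer (\<alpha> + 3) k)"
      using pochhammer_rec[of "\<alpha> + 1" "Suc k"] pochhammer_rec[of "\<alpha> + 2" k]
      by (simp add: k add_ac del: pochhammer_Suc)
    moreover have "pochhammer (\<alpha> + 3) k > 0" using that by (intro pochhammer_pos) auto
    moreover have "1 + (2 * x - 2) / (\<alpha> + 2) = (2 * x + \<alpha>) / (\<alpha> + 2)" 
       "1 + (2 * x - 2) / (\<alpha> + 1) = (2 * x + \<alpha> - 1) / (\<alpha> + 1)"
      using that by (simp_all add: field_simps)
    ultimately show ?thesis using c[OF that] by (simp add: mult_ac)
  qed
  have "scaled_coeff \<mu> n \<le> scaled_coeff \<nu> n"
    unfolding c'[OF assms(1)] c'[OF less_le_trans[OF assms(1,2)]]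
    using assms K x
    by (intro mult_left_mono frac_le mult_mono add_left_mono divide_left_mono mult_nonneg_nonneg mult_pos_pos
        pochhammer_mono pochhammer_pos add_nonneg_nonneg divide_nonneg_nonneg) auto
  moreover have "(1 - x * (\<mu> - \<nu>) / 2) * scaled_coeff \<nu> n \<le> scaled_coeff \<mu> n"
  proof -
    define L where "L = 1 - x * (\<mu> - \<nu>) / 2"
    have "L * pochhammer (\<mu> + 1) n \<le> pochhammer (\<nu> + 1) n"
      using pochhammer_shift_le[of "\<nu> + 1" "\<mu> + 1" n] assms by (simp add: L_def x_def)
    hence "L / pochhammer (\<nu> + 1) n \<le> 1 / pochhammer (\<mu> + 1) n"
      using pn pm by (simp add: field_simps)
    hence "K * ((2 * x + \<nu>) * (2 * x + \<nu> - 1)) * (L / pochhammer (\<nu> + 1) n)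
        \<le> K * ((2 * x + \<nu>) * (2 * x + \<nu> - 1)) * (1 / pochhammer (\<mu> + 1) n)"
      using K x assms by (intro mult_left_mono mult_nonneg_nonneg) auto
    also have "\<dots> \<le> K * ((2 * x + \<mu>) * (2 * x + \<mu> - 1)) * (1 / pochhammer (\<mu> + 1) n)"
      using K x assms pm by (intro mult_right_mono mult_left_mono mult_mono) auto
    finally show ?thesis using c[OF assms(1)] c[of \<mu>] assms unfolding L_def[symmetric] by (simp add: mult_ac)
  qed
  moreover have "(1 - x * (\<mu> - \<nu>) / 2) * scaled_coeff \<nu> n = scaled_coeff \<nu> n - (\<mu> - \<nu>) * (x / 2 * scaled_coeff \<nu> n)"
    by (simp add: algebra_simps)
  ultimately show ?thesis unfolding x_def[symmetric] by linarith
qed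

text \<open>
  The first two terms of the series contribute \<open>\<nu>\<^sup>2 - \<nu> - (\<nu> + 2) / 2\<close>, whose increment is
  \<open>(\<mu> - \<nu>) * (\<mu> + \<nu> - 3/2)\<close>; the increments of all others are bounded through
  \<open>\<Sum>n\<ge>2. n * (n + 1) * F_coeff \<nu> n \<le> 35/36 * F_coeff \<nu> 1\<close>.
\<close>
lemma scaled_deriv_at_1_increment:
  assumes "1 < \<nu>" "\<nu> \<le> \<mu>"
  shows "\<bar>scaled_deriv_at_1 \<mu> - scaled_deriv_at_1 \<nu> - (\<mu> - \<nu>) * (\<mu> + \<nu> - 3 / 2)\<bar> \<le> (\<mu> - \<nu>) * (35 / 288 * (\<nu> + 2))"
proof -
  have \<mu>: "\<mu> > 1" using assms by simp
  have s: "(\<lambda>n. (-1) ^ n * scaled_coeff \<alpha> n) sums scaled_deriv_at_1 \<alpha>" if "\<alpha> > 1" for \<alpha>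
    using sums_mult[OF deriv_bessel_F_1_sums[OF that], of "\<alpha> * (\<alpha> - 1)"]
    by (simp add: scaled_deriv_at_1_def scaled_coeff_def deriv_coeff_def mult_ac)
  have "(\<lambda>n. (-1) ^ n * scaled_coeff \<mu> n - (-1) ^ n * scaled_coeff \<nu> n) sums (scaled_deriv_at_1 \<mu> - scaled_deriv_at_1 \<nu>)"
    by (intro sums_diff s \<mu> assms)
  hence "(\<lambda>n. (-1) ^ n * (scaled_coeff \<mu> n - scaled_coeff \<nu> n)) sums (scaled_deriv_at_1 \<mu> - scaled_deriv_at_1 \<nu>)"
    by (simp add: right_diff_distrib)
  hence "(\<lambda>n. (-1) ^ (n + 2) * (scaled_coeff \<mu> (n + 2) - scaled_coeff \<nu> (n + 2))) sums
     (scaled_deriv_at_1 \<mu> - scaled_deriv_at_1 \<nu> - (\<Sum>n<2. (-1) ^ n * (scaled_coeff \<mu> n - scaled_coeff \<nu> n)))"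
    by (subst sums_iff_shift')
  moreover have "(\<Sum>n<2. (-1) ^ n * (scaled_coeff \<mu> n - scaled_coeff \<nu> n)) = (\<mu> - \<nu>) * (\<mu> + \<nu> - 3 / 2)"
  proof -
    have c01: "scaled_coeff \<alpha> 0 = \<alpha> * (\<alpha> - 1)" "scaled_coeff \<alpha> 1 = (\<alpha> + 2) / 2" if "\<alpha> > 1" for \<alpha>
      unfolding scaled_coeff_def F_coeff_1[OF that] F_coeff_0[OF that] using that
      by (simp_all add: divide_simps) (simp add: algebra_simps)
    have "(\<Sum>n<2. (-1) ^ n * (scaled_coeff \<mu> n - scaled_coeff \<nu> n))
        = (scaled_coeff \<mu> 0 - scaled_coeff \<nu> 0) - (scaled_coeff \<mu> 1 - scaled_coeff \<nu> 1)"
      by (simp add: numeral_2_eq_2)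
    also have "\<dots> = (\<mu> - \<nu>) * (\<mu> + \<nu> - 3 / 2)"
      unfolding c01[OF \<mu>] c01[OF assms(1)] by (simp add: field_simps)
    finally show ?thesis .
  qed
  ultimately have tail: "(\<lambda>n. (-1) ^ (n + 2) * (scaled_coeff \<mu> (n + 2) - scaled_coeff \<nu> (n + 2))) sums
     (scaled_deriv_at_1 \<mu> - scaled_deriv_at_1 \<nu> - (\<mu> - \<nu>) * (\<mu> + \<nu> - 3 / 2))" by simp
  define w where "w n = real n * (real n + 1) * F_coeff \<nu> n" for n
  have w: "summable (\<lambda>n. w (n + 2))" "(\<Sum>n. w (n + 2)) \<le> 35 / 36 * F_coeff \<nu> 1"
    using moment_dominated[OF assms(1), of "1 / 2" w] coeff_le_moment(1)[OF assms(1)] F_coeff_pos[OF assms(1)]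
    by (auto simp: w_def less_imp_le)
  define C where "C = (\<mu> - \<nu>) * (\<nu> * (\<nu> - 1) / 2)"
  have C: "C \<ge> 0" using assms by (simp add: C_def)
  have "norm (scaled_deriv_at_1 \<mu> - scaled_deriv_at_1 \<nu> - (\<mu> - \<nu>) * (\<mu> + \<nu> - 3 / 2)) \<le> C * (\<Sum>n. w (n + 2))"
  proof (rule norm_sums_le[OF tail sums_mult[OF summable_sums[OF w(1)]]])
    fix n
    show "norm ((-1) ^ (n + 2) * (scaled_coeff \<mu> (n + 2) - scaled_coeff \<nu> (n + 2))) \<le> C * w (n + 2)"
      using scaled_coeff_diff[OF assms, of "n + 2"]
      by (simp add: abs_mult C_def w_def scaled_coeff_def mult_ac)
  qed
  also have "\<dots> \<le> C * (35 / 36 * F_coeff \<nu> 1)" by (rule mult_left_mono[OF w(2) C])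
  also have "\<dots> = (\<mu> - \<nu>) * (35 / 288 * (\<nu> + 2))"
    unfolding F_coeff_1[OF assms(1)] C_def using assms(1)
    by (simp add: divide_simps) (simp add: algebra_simps)
  finally show ?thesis by simp
qed

lemma scaled_deriv_at_1_strict_mono:
  assumes "1 < \<nu>" "\<nu> < \<mu>"
  shows "scaled_deriv_at_1 \<nu> < scaled_deriv_at_1 \<mu>"
proof -
  have "(\<mu> - \<nu>) * (35 / 288 * (\<nu> + 2)) < (\<mu> - \<nu>) * (\<mu> + \<nu> - 3 / 2)"
    using assms by (intro mult_strict_left_mono) auto
  thus ?thesis using scaled_deriv_at_1_increment[of \<nu> \<mu>] assms by linarith
qed

lemma continuous_on_scaled_deriv_at_1:
  assumes "1 < a" "b \<le> 2"
  shows "continuous_on {a..b} scaled_deriv_at_1"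
proof -
  have le: "\<bar>scaled_deriv_at_1 y - scaled_deriv_at_1 x\<bar> \<le> 4 * (y - x)" if "x \<in> {a..b}" "y \<in> {a..b}" "x \<le> y" for x y
  proof -
    have "\<bar>scaled_deriv_at_1 y - scaled_deriv_at_1 x - (y - x) * (y + x - 3 / 2)\<bar> \<le> (y - x) * (35 / 288 * (x + 2))"
      using scaled_deriv_at_1_increment[of x y] that assms by simp
    moreover have "0 \<le> (y - x) * (y + x - 3 / 2)"
      using that assms by (intro mult_nonneg_nonneg) auto
    moreover have "(y - x) * (y + x - 3 / 2) \<le> (y - x) * (5 / 2)"
      by (rule mult_left_mono) (use that assms in auto)
    moreover have "(y - x) * (35 / 288 * (x + 2)) \<le> (y - x) * (3 / 2)"
      by (rule mult_left_mono) (use that assms in auto)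
    ultimately show ?thesis by linarith
  qed
  have "4-lipschitz_on {a..b} scaled_deriv_at_1"
  proof (rule lipschitz_onI)
    fix x y assume "x \<in> {a..b}" "y \<in> {a..b}"
    thus "dist (scaled_deriv_at_1 x) (scaled_deriv_at_1 y) \<le> 4 * dist x y"
      using le[of x y] le[of y x] by (cases "x \<le> y") (auto simp: dist_real_def)
  qed simp
  thus ?thesis by (rule lipschitz_on_continuous_on)
qed

text \<open>
  From \<open>n = 4\<close> on, a term of the series is at most \<open>1/16\<close> of the corresponding moment, and the moments
  decrease by a factor of at least seven.
\<close>
lemma deriv_bessel_F_1_approx:
  assumes "\<nu> > 1"
  shows "\<bar>Re (deriv (bessel_F \<nu>) 1) - (1 - 2 * F_coeff \<nu> 1 + 3 * F_coeff \<nu> 2 - 4 * F_coeff \<nu> 3)\<bar> \<le> 3 / 8 * F_coeff \<nu> 3"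
proof -
  have "(\<lambda>n. deriv_coeff \<nu> (n + 4)) sums (Re (deriv (bessel_F \<nu>) 1) - (\<Sum>n<4. deriv_coeff \<nu> n))"
    using deriv_bessel_F_1_sums[OF assms] by (subst sums_iff_shift')
  also have "(\<Sum>n<4. deriv_coeff \<nu> n) = 1 - 2 * F_coeff \<nu> 1 + 3 * F_coeff \<nu> 2 - 4 * F_coeff \<nu> 3"
    by (simp add: eval_nat_numeral deriv_coeff_def F_coeff_0[OF assms])
  finally have s: "(\<lambda>n. deriv_coeff \<nu> (n + 4)) sums (Re (deriv (bessel_F \<nu>) 1) -
      (1 - 2 * F_coeff \<nu> 1 + 3 * F_coeff \<nu> 2 - 4 * F_coeff \<nu> 3))" .
  have geo: "moment \<nu> (n + 4) \<le> moment \<nu> 3 / 7 * (1 / 7) ^ n" for n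
  proof (induction n)
    case 0 thus ?case using moment_ratio[OF assms, of 3] by simp
  next
    case (Suc n) thus ?case using moment_ratio[OF assms, of "n + 4"] by simp
  qed
  have "norm (Re (deriv (bessel_F \<nu>) 1) - (1 - 2 * F_coeff \<nu> 1 + 3 * F_coeff \<nu> 2 - 4 * F_coeff \<nu> 3))
       \<le> moment \<nu> 3 / 112 * (1 / (1 - 1 / 7))"
  proof (rule norm_sums_le[OF s sums_mult[OF geometric_sums]])
    fix n
    have "16 * norm (deriv_coeff \<nu> (n + 4)) = 4\<^sup>2 * ((real (n + 4) + 1) * F_coeff \<nu> (n + 4))"
      by (simp add: abs_deriv_coeff[OF assms])
    also have "\<dots> \<le> (real (n + 4))\<^sup>2 * ((real (n + 4) + 1) * F_coeff \<nu> (n + 4))"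
      using F_coeff_pos[OF assms, of "n + 4"] by (intro mult_right_mono power_mono) auto
    also have "\<dots> = moment \<nu> (n + 4)" by (simp add: moment_def)
    finally show "norm (deriv_coeff \<nu> (n + 4)) \<le> moment \<nu> 3 / 112 * (1 / 7) ^ n"
      using geo[of n] by simp
  qed simp
  thus ?thesis by (simp add: moment_def)
qed

text \<open>
  Both orders are less than \<open>1/1000\<close> away from \<open>1.9052\<close>, and far enough from the zero near \<open>1.9046\<close> for
  the error bound of the approximation.
\<close>
lemma deriv_bessel_F_1_signs:
  "Re (deriv (bessel_F (7617 / 4000)) 1) < 0" "Re (deriv (bessel_F (953 / 500)) 1) > 0"
proof -
  have "F_coeff \<nu> 2 = (4 + \<nu>) * (3 + \<nu>) / (32 * ((\<nu> - 1) * \<nu> * (\<nu> + 1) * (\<nu> + 2)))"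
       "F_coeff \<nu> 3 = (6 + \<nu>) * (5 + \<nu>) / (384 * ((\<nu> - 1) * \<nu> * (\<nu> + 1) * (\<nu> + 2) * (\<nu> + 3)))" for \<nu>
    by (simp_all add: F_coeff_def eval_nat_numeral pochhammer_Suc algebra_simps)
  note F = this F_coeff_1[simplified]
  have "1 - 2 * F_coeff (7617 / 4000) 1 + 3 * F_coeff (7617 / 4000) 2 - 4 * F_coeff (7617 / 4000) 3
      + 3 / 8 * F_coeff (7617 / 4000) 3 < 0"
    by (simp add: F)
  thus "Re (deriv (bessel_F (7617 / 4000)) 1) < 0"
    using deriv_bessel_F_1_approx[of "7617 / 4000"] by linarith
  have "1 - 2 * F_coeff (953 / 500) 1 + 3 * F_coeff (953 / 500) 2 - 4 * F_coeff (953 / 500) 3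
      - 3 / 8 * F_coeff (953 / 500) 3 > 0"
    by (simp add: F)
  thus "Re (deriv (bessel_F (953 / 500)) 1) > 0"
    using deriv_bessel_F_1_approx[of "953 / 500"] by linarith
qed

section \<open>The critical order\<close>

theorem theorem4:
  shows "\<exists>\<nu>star::real.
     \<nu>star > 1 \<and>
     of_real (2 * \<nu>star\<^sup>2 - 2 * \<nu>star - 3) * bessel_J \<nu>star 1
       = of_real (\<nu>star\<^sup>2 + \<nu>star - 3) * bessel_J (\<nu>star + 1) 1 \<and>
     (\<forall>\<mu>::real. \<mu> > 1 \<longrightarrow>
        of_real (2 * \<mu>\<^sup>2 - 2 * \<mu> - 3) * bessel_J \<mu> 1
          = of_real (\<mu>\<^sup>2 + \<mu> - 3) * bessel_J (\<mu> + 1) 1 \<longrightarrow> \<mu> = \<nu>star) \<and>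
     \<bar>\<nu>star - 1.9052\<bar> < 1 / 1000 \<and>
     (\<forall>\<nu>::real. \<nu> > 1 \<longrightarrow>
        ((starlike_fun (bessel_F \<nu>) \<and>
          (\<forall>n\<ge>1. close_to_convex ((deriv ^^ n) (bessel_F \<nu>))))
           \<longleftrightarrow> \<nu> \<ge> \<nu>star) \<and>
        (\<forall>n\<ge>1. close_to_convex ((deriv ^^ n) (bessel_F \<nu>))
           \<longrightarrow> inj_on ((deriv ^^ n) (bessel_F \<nu>)) (ball 0 1)))"
proof -
  have "scaled_deriv_at_1 (7617 / 4000) \<le> 0" "0 \<le> scaled_deriv_at_1 (953 / 500)"
    using deriv_bessel_F_1_signs by (simp_all add: scaled_deriv_at_1_def mult_nonneg_nonpos mult_nonneg_nonneg)
  hence "\<exists>x\<ge>7617 / 4000. x \<le> 953 / 500 \<and> scaled_deriv_at_1 x = 0"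
    by (intro IVT' continuous_on_scaled_deriv_at_1) auto
  then obtain s where s: "7617 / 4000 \<le> s" "s \<le> 953 / 500" "scaled_deriv_at_1 s = 0" by blast
  have s1: "s > 1" using s by simp
  have mono: "scaled_deriv_at_1 \<mu> < scaled_deriv_at_1 \<nu> \<longleftrightarrow> \<mu> < \<nu>" if "\<mu> > 1" "\<nu> > 1" for \<mu> \<nu>
    using scaled_deriv_at_1_strict_mono[of \<mu> \<nu>] scaled_deriv_at_1_strict_mono[of \<nu> \<mu>] that by (cases \<mu> \<nu> rule: linorder_cases) auto
  have sgn: "Re (deriv (bessel_F \<nu>) 1) \<ge> 0 \<longleftrightarrow> scaled_deriv_at_1 \<nu> \<ge> 0"
      "Re (deriv (bessel_F \<nu>) 1) = 0 \<longleftrightarrow> scaled_deriv_at_1 \<nu> = 0" if "\<nu> > 1" for \<nu>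
  proof -
    define k where "k = \<nu> * (\<nu> - 1)"
    have "k > 0" using that by (simp add: k_def)
    thus "Re (deriv (bessel_F \<nu>) 1) \<ge> 0 \<longleftrightarrow> scaled_deriv_at_1 \<nu> \<ge> 0"
      "Re (deriv (bessel_F \<nu>) 1) = 0 \<longleftrightarrow> scaled_deriv_at_1 \<nu> = 0"
      by (auto simp: scaled_deriv_at_1_def zero_le_mult_iff simp flip: k_def)
  qed
  have root: "of_real (2 * \<nu>\<^sup>2 - 2 * \<nu> - 3) * bessel_J \<nu> 1 = of_real (\<nu>\<^sup>2 + \<nu> - 3) * bessel_J (\<nu> + 1) 1
      \<longleftrightarrow> \<nu> = s" if "\<nu> > 1" for \<nu>
    unfolding bessel_J_equation_iff[OF that] sgn(2)[OF that]
    using mono[OF that s1] mono[OF s1 that] s(3) by (cases \<nu> s rule: linorder_cases) auto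
  have star: "starlike_fun (bessel_F \<nu>) \<longleftrightarrow> \<nu> \<ge> s" if "\<nu> > 1" for \<nu>
    unfolding starlike_bessel_F_iff[OF that] sgn(1)[OF that]
    using mono[OF that s1] s(3) by (simp add: not_less[symmetric])
  have near: "\<bar>s - 1.9052\<bar> < 1 / 1000" using s unfolding abs_less_iff by simp
  show ?thesis
    using near s1 root star higher_deriv_bessel_F_close_to_convex
    by (intro exI[of _ s]) auto
qed

end
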